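(* Assume that $(A_1)$–$(A_3)$ hold and that $\varepsilon>0$ is sufficiently small. The slow manifold $\mathcal M^\varepsilon(\omega)=\{(x_0,\hat h^\varepsilon(\omega,x_0)):x_0\in\mathbb R^{n_1}\}$ of the system $$d\hat x^\varepsilon=S\hat x^\varepsilon dt+g_1(\hat x^\varepsilon,\hat y^\varepsilon+\sigma\eta^{\frac1\varepsilon}(\theta_t\omega))dt,\qquad d\hat y^\varepsilon=\tfrac1\varepsilon F\hat y^\varepsilon dt+\tfrac1\varepsilon g_2(\hat x^\varepsilon,\hat y^\varepsilon+\sigma\eta^{\frac1\varepsilon}(\theta_t\omega))dt$$ is the same in distribution as the slow manifold $\tilde{\mathcal M}^\varepsilon(\omega)=\{(x_0,\tilde h^\varepsilon(\omega,x_0)):x_0\in\mathbb R^{n_1}\}$ of the system $$d\tilde x^\varepsilon=\varepsilon S\tilde x^\varepsilon dt+\varepsilon g_1(\tilde x^\varepsilon,\tilde y^\varepsilon+\sigma\xi(\theta_t\omega))dt,\qquad d\tilde y^\varepsilon=F\tilde y^\varepsilon dt+g_2(\tilde x^\varepsilon,\tilde y^\varepsilon+\sigma\xi(\theta_t\omega))dt .$$ That is, for every $x_0\in\mathbb R^{n_1}$, $$\hat h^\varepsilon(\omega,x_0)\stackrel d=\tilde h^\varepsilon(\omega,x_0).$$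
   Context: Setting. $|\cdot|$ is the Euclidean norm, $n=n_1+n_2$, $\sigma>0$, $1<\alpha<2$. $S$ is an $n_1\times n_1$ matrix all of whose eigenvalues have non-negative real part, $F$ is an $n_2\times n_2$ matrix all of whose eigenvalues have negative real part, and $g_i:\mathbb R^{n_1}\times\mathbb R^{n_2}\to\mathbb R^{n_i}$ ($i=1,2$) are Lipschitz continuous with $g_i(0,0)=0$. Hypotheses. $(A_1)$: there are constants $\gamma_s>0$ and $\gamma_f<0$ such that $|e^{St}x|\le e^{\gamma_st}|x|$ for $t\le0$, $x\in\mathbb R^{n_1}$, and $|e^{Ft}y|\le e^{\gamma_ft}|y|$ for $t\ge0$, $y\in\mathbb R^{n_2}$. $(A_2)$: there is $K>0$ with $|g_i(x_1,y_1)-g_i(x_2,y_2)|\le K(|x_1-x_2|+|y_1-y_2|)$ for all $(x_j,y_j)\in\mathbb R^n$, $i=1,2$. $(A_3)$: $K<-\gamma_f$. A number $\gamma>0$ with $K<-(\gamma+\gamma_f)$ is fixed, and $\beta=-\gamma/\varepsilon$. Noise. $\Omega=\mathcal D_0(\mathbb R,\mathbb R^{n_2})$ is the space of càdlàg functions $\omega:\mathbb R\to\mathbb R^{n_2}$ with $\omega(0)=0$, with the Borel $\sigma$-algebra of the Skorokhod topology; $\mathbb P$ is the law making $L_t^\alpha(\omega)=\omega(t)$ a two-sided $\alpha$-stable Lévy process, which is self-similar: $L^\alpha_{ct}\stackrel d=c^{1/\alpha}L^\alpha_t$ (as processes in $t$) for $c>0$; $\theta_t\omega=\omega(\cdot+t)-\omega(t)$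 is the shift flow, which preserves $\mathbb P$. On a $\theta$-invariant set of full measure (again denoted $\Omega$) put $\eta^{\frac1\varepsilon}(\omega)=\varepsilon^{-\frac1\alpha}\int_{-\infty}^0e^{-Fs/\varepsilon}dL_s^\alpha(\omega)$ and $\xi(\omega)=\int_{-\infty}^0e^{-Fs}dL_s^\alpha(\omega)$; $t\mapsto\eta^{\frac1\varepsilon}(\theta_t\omega)$ and $t\mapsto\xi(\theta_t\omega)$ are càdlàg with sublinear growth. $\stackrel d=$ denotes equality in distribution. Manifolds. For $\hat\beta\in\mathbb R$, $C_{\hat\beta}^-$ is the Banach space of continuous $(\phi^s,\phi^f):(-\infty,0]\to\mathbb R^{n_1}\times\mathbb R^{n_2}$ with finite norm $\sup_{t\le0}|e^{-\hat\beta t}\phi^s_t|+\sup_{t\le0}|e^{-\hat\beta t}\phi^f_t|$. For sufficiently small $\varepsilon>0$ and each $x_0\in\mathbb R^{n_1}$: (i) $\hat h^\varepsilon(\omega,x_0)=\frac1\varepsilon\int_{-\infty}^0e^{-Fs/\varepsilon}g_2(\hat x^\varepsilon(s),\hat y^\varepsilon(s)+\sigma\eta^{\frac1\varepsilon}(\theta_s\omega))ds$, where $(\hat x^\varepsilon,\hat y^\varepsilon)$ is the unique element of $C_\beta^-$ with, for $t\le0$, $\hat x^\varepsilon(t)=e^{St}x_0+\int_0^te^{S(t-s)}g_1(\hat x^\varepsilon(s),\hat y^\varepsilon(s)+\sigma\eta^{\frac1\varepsilon}(\theta_s\omega))ds$ and $\hat y^\varepsilon(t)=\frac1\varepsilon\int_{-\infty}^te^{F(t-s)/\varepsilon}g_2(\hat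 x^\varepsilon(s),\hat y^\varepsilon(s)+\sigma\eta^{\frac1\varepsilon}(\theta_s\omega))ds$; (ii) $\tilde h^\varepsilon(\omega,x_0)=\int_{-\infty}^0e^{-Fs}g_2(\tilde x^\varepsilon(s),\tilde y^\varepsilon(s)+\sigma\xi(\theta_s\omega))ds$, where $(\tilde x^\varepsilon,\tilde y^\varepsilon)$ is the unique element of $C_{-\gamma}^-$ with, for $t\le0$, $\tilde x^\varepsilon(t)=e^{S\varepsilon t}x_0+\varepsilon\int_0^te^{S\varepsilon(t-s)}g_1(\tilde x^\varepsilon(s),\tilde y^\varepsilon(s)+\sigma\xi(\theta_s\omega))ds$ and $\tilde y^\varepsilon(t)=\int_{-\infty}^te^{F(t-s)}g_2(\tilde x^\varepsilon(s),\tilde y^\varepsilon(s)+\sigma\xi(\theta_s\omega))ds$. *)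

theory Defs
  imports "HOL-Probability.Probability"
begin

text \<open>On \<^typ>\<open>real^'n^'n\<close> there is no algebra instance for matrix multiplication, so the
  library's \<^const>\<open>exp\<close> does not apply and the exponential series is written out.\<close>

definition mexp :: "real^'n^'n \<Rightarrow> real^'n^'n" where
  "mexp A = (\<Sum>k. (1 / fact k) *\<^sub>R (((\<lambda>B. A ** B) ^^ k) (mat 1)))"

definition cmat_eigenvalue :: "real^'n^'n \<Rightarrow> complex \<Rightarrow> bool" where
  "cmat_eigenvalue A z \<longleftrightarrow>
     (\<exists>v :: complex^'n. v \<noteq> 0 \<and> map_matrix complex_of_real A *v v = z *s v)"

definition cadlag :: "(real \<Rightarrow> 'b::topological_space) \<Rightarrow> bool" where
  "cadlag f \<longleftrightarrow> (\<forall>t. (f \<longlongrightarrow> f t) (at_right t) \<and> (\<exists>l. (f \<longlongrightarrow> l) (at_left t)))"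

definition D0 :: "(real \<Rightarrow> 'b::real_normed_vector) set" where
  "D0 = {\<omega>. cadlag \<omega> \<and> \<omega> 0 = 0}"

text \<open>Time changes are the increasing bijections of the line (they are automatically
  homeomorphisms). A sequence \<open>\<omega>\<^sub>k\<close> is eventually in every basic neighbourhood of \<open>\<omega>\<close> iff there
  are time changes \<open>l\<^sub>k\<close> converging to the identity uniformly on the line with
  \<open>\<omega>\<^sub>k \<circ> l\<^sub>k \<longrightarrow> \<omega>\<close> uniformly on compact sets; this is Skorokhod convergence, and since the
  Skorokhod topology is metrizable, the open sets below are exactly its open sets.\<close>

definition skorokhod_nbhd ::
    "(real \<Rightarrow> 'b::real_normed_vector) \<Rightarrow> real \<Rightarrow> real \<Rightarrow> (real \<Rightarrow> 'b) set" where
  "skorokhod_nbhd \<omega> N d =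
     {\<omega>' \<in> D0. \<exists>l :: real \<Rightarrow> real. strict_mono l \<and> surj l \<and> (\<forall>t. \<bar>l t - t\<bar> < d) \<and>
        (\<forall>t\<in>{-N..N}. norm (\<omega>' (l t) - \<omega> t) < d)}"

definition skorokhod_open :: "(real \<Rightarrow> 'b::real_normed_vector) set \<Rightarrow> bool" where
  "skorokhod_open U \<longleftrightarrow>
     U \<subseteq> D0 \<and> (\<forall>\<omega>\<in>U. \<exists>N>0. \<exists>d>0. skorokhod_nbhd \<omega> N d \<subseteq> U)"

lemma skorokhod_nbhd_mono:
  assumes "N \<le> N'" "d' \<le> d"
  shows "skorokhod_nbhd \<omega> N' d' \<subseteq> skorokhod_nbhd \<omega> N d"
proof
  fix \<omega>' assume "\<omega>' \<in> skorokhod_nbhd \<omega> N' d'"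
  then obtain l :: "real \<Rightarrow> real" where "\<omega>' \<in> D0" "strict_mono l" "surj l"
      and l: "\<And>t. \<bar>l t - t\<bar> < d'" "\<And>t. t \<in> {-N'..N'} \<Longrightarrow> norm (\<omega>' (l t) - \<omega> t) < d'"
    by (auto simp: skorokhod_nbhd_def)
  moreover have "\<bar>l t - t\<bar> < d" for t
    using l(1)[of t] assms by linarith
  moreover have "norm (\<omega>' (l t) - \<omega> t) < d" if "t \<in> {-N..N}" for t
    using l(2)[of t] that assms by auto
  ultimately show "\<omega>' \<in> skorokhod_nbhd \<omega> N d"
    unfolding skorokhod_nbhd_def by blast
qed

lemma istopology_skorokhod_open:
  "istopology (skorokhod_open :: (real \<Rightarrow> 'b::real_normed_vector) set \<Rightarrow> bool)"
  unfolding istopology_def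
proof (intro conjI allI impI)
  fix U V :: "(real \<Rightarrow> 'b::real_normed_vector) set"
  assume U: "skorokhod_open U" and V: "skorokhod_open V"
  show "skorokhod_open (U \<inter> V)"
    unfolding skorokhod_open_def
  proof (intro conjI ballI)
    show "U \<inter> V \<subseteq> D0" using U by (auto simp: skorokhod_open_def)
    fix \<omega> assume "\<omega> \<in> U \<inter> V"
    then obtain N d N' d' where *: "N > 0" "d > 0" "skorokhod_nbhd \<omega> N d \<subseteq> U"
        "N' > 0" "d' > 0" "skorokhod_nbhd \<omega> N' d' \<subseteq> V"
      using U V unfolding skorokhod_open_def by blast
    have "skorokhod_nbhd \<omega> (max N N') (min d d') \<subseteq> U \<inter> V"
      using * skorokhod_nbhd_mono[of N "max N N'" "min d d'" d \<omega>]
        skorokhod_nbhd_mono[of N' "max N N'" "min d d'" d' \<omega>] by auto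
    then show "\<exists>N>0. \<exists>d>0. skorokhod_nbhd \<omega> N d \<subseteq> U \<inter> V"
      using * by (intro exI[of _ "max N N'"] conjI exI[of _ "min d d'"]) auto
  qed
next
  fix \<U> :: "(real \<Rightarrow> 'b::real_normed_vector) set set"
  assume *: "\<forall>U\<in>\<U>. skorokhod_open U"
  show "skorokhod_open (\<Union>\<U>)"
    unfolding skorokhod_open_def
  proof (intro conjI ballI)
    show "\<Union>\<U> \<subseteq> D0" using * by (auto simp: skorokhod_open_def)
    fix \<omega> assume "\<omega> \<in> \<Union>\<U>"
    then obtain U where "U \<in> \<U>" "\<omega> \<in> U" by blast
    then obtain N d where "N > 0" "d > 0" "skorokhod_nbhd \<omega> N d \<subseteq> U"
      using * unfolding skorokhod_open_def by blast
    then show "\<exists>N>0. \<exists>d>0. skorokhod_nbhd \<omega> N d \<subseteq> \<Union>\<U>"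
      using \<open>U \<in> \<U>\<close> by blast
  qed
qed

definition skorokhod_topology :: "(real \<Rightarrow> 'b::real_normed_vector) topology" where
  "skorokhod_topology = topology skorokhod_open"

lemma openin_skorokhod [simp]: "openin skorokhod_topology U \<longleftrightarrow> skorokhod_open U"
  by (simp add: skorokhod_topology_def topology_inverse'[OF istopology_skorokhod_open])

definition skorokhod_borel :: "(real \<Rightarrow> 'b::real_normed_vector) measure" where
  "skorokhod_borel = sigma D0 {U. openin skorokhod_topology U}"

definition path_shift :: "real \<Rightarrow> (real \<Rightarrow> 'b::real_normed_vector) \<Rightarrow> (real \<Rightarrow> 'b)" where
  "path_shift t \<omega> = (\<lambda>s. \<omega> (s + t) - \<omega> t)"

text \<open>A two-sided Levy process is a cadlag process on the whole line, started at 0, with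
  stationary and independent increments over the whole line. Stochastic continuity follows from
  cadlag paths and stationarity of the increments.\<close>

definition two_sided_levy_process ::
    "'a measure \<Rightarrow> (real \<Rightarrow> 'a \<Rightarrow> 'b::euclidean_space) \<Rightarrow> bool" where
  "two_sided_levy_process M X \<longleftrightarrow>
     prob_space M \<and>
     (\<forall>t. X t \<in> borel_measurable M) \<and>
     (\<forall>\<omega>\<in>space M. X 0 \<omega> = 0 \<and> cadlag (\<lambda>t. X t \<omega>)) \<and>
     (\<forall>(\<tau> :: nat \<Rightarrow> real) n. mono \<tau> \<longrightarrow>
        prob_space.indep_vars M (\<lambda>_. borel) (\<lambda>i \<omega>. X (\<tau> (Suc i)) \<omega> - X (\<tau> i) \<omega>) {..<n}) \<and>
     (\<forall>s t. s \<le> t \<longrightarrow>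
        distr M borel (\<lambda>\<omega>. X t \<omega> - X s \<omega>) = distr M borel (X (t - s)))"

text \<open>Strict stability, a condition on the one-dimensional marginals, is the form of
  \<open>\<alpha>\<close>-stability that yields self-similarity; the process that vanishes almost surely is
  excluded.\<close>

definition stable_levy_process ::
    "real \<Rightarrow> 'a measure \<Rightarrow> (real \<Rightarrow> 'a \<Rightarrow> 'b::euclidean_space) \<Rightarrow> bool" where
  "stable_levy_process \<alpha> M X \<longleftrightarrow>
     two_sided_levy_process M X \<and>
     (\<forall>t>0. distr M borel (X t) = distr M borel (\<lambda>\<omega>. (t powr (1 / \<alpha>)) *\<^sub>R X 1 \<omega>)) \<and>
     \<not> (AE \<omega> in M. X 1 \<omega> = 0)"

definition stable_levy_law :: "real \<Rightarrow> (real \<Rightarrow> 'b::euclidean_space) measure \<Rightarrow> bool" where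
  "stable_levy_law \<alpha> P \<longleftrightarrow>
     sets P = sets skorokhod_borel \<and> stable_levy_process \<alpha> P (\<lambda>t \<omega>. \<omega> t)"

text \<open>The integrands are smooth matrix-valued functions of time and the paths are cadlag, so
  that the integral over a compact interval exists path by path as a Riemann-Stieltjes integral.
  The integral over the negative half-line is its improper version.\<close>

definition has_rs_integral ::
    "(real \<Rightarrow> real^'n^'n) \<Rightarrow> (real \<Rightarrow> real^'n) \<Rightarrow> real^'n \<Rightarrow> real \<Rightarrow> real \<Rightarrow> bool" where
  "has_rs_integral \<Phi> \<omega> I a b \<longleftrightarrow>
     (\<forall>e>0. \<exists>d>0. \<forall>p. p tagged_division_of {a..b} \<and> (\<lambda>x. ball x d) fine p \<longrightarrow>
        norm ((\<Sum>(x, K)\<in>p. \<Phi> x *v (\<omega> (Sup K) - \<omega> (Inf K))) - I) < e)"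

definition has_rs_integral_minf ::
    "(real \<Rightarrow> real^'n^'n) \<Rightarrow> (real \<Rightarrow> real^'n) \<Rightarrow> real^'n \<Rightarrow> bool" where
  "has_rs_integral_minf \<Phi> \<omega> I \<longleftrightarrow>
     (\<exists>J. (\<forall>T>0. has_rs_integral \<Phi> \<omega> (J T) (-T) 0) \<and> (J \<longlongrightarrow> I) at_top)"

definition rs_integral_minf ::
    "(real \<Rightarrow> real^'n^'n) \<Rightarrow> (real \<Rightarrow> real^'n) \<Rightarrow> real^'n" where
  "rs_integral_minf \<Phi> \<omega> = (THE I. has_rs_integral_minf \<Phi> \<omega> I)"

definition eta :: "real \<Rightarrow> real^'n^'n \<Rightarrow> real \<Rightarrow> (real \<Rightarrow> real^'n) \<Rightarrow> real^'n" where
  "eta \<alpha> F \<epsilon> \<omega> = (\<epsilon> powr (- 1 / \<alpha>)) *\<^sub>R rs_integral_minf (\<lambda>s. mexp ((- s / \<epsilon>) *\<^sub>R F)) \<omega>"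

definition xi :: "real^'n^'n \<Rightarrow> (real \<Rightarrow> real^'n) \<Rightarrow> real^'n" where
  "xi F \<omega> = rs_integral_minf (\<lambda>s. mexp ((- s) *\<^sub>R F)) \<omega>"

definition sublinear_growth :: "(real \<Rightarrow> 'b::real_normed_vector) \<Rightarrow> bool" where
  "sublinear_growth f \<longleftrightarrow> ((\<lambda>t. norm (f t) / \<bar>t\<bar>) \<longlongrightarrow> 0) at_infinity"

text \<open>The shift-invariant sets of full measure to which the sample space is restricted: on them
  the two stationary processes are defined and have cadlag paths of sublinear growth.\<close>

definition full_invariant_set ::
    "real \<Rightarrow> real^'n^'n \<Rightarrow> real \<Rightarrow> (real \<Rightarrow> real^'n) measure \<Rightarrow> (real \<Rightarrow> real^'n) set \<Rightarrow> bool" where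
  "full_invariant_set \<alpha> F \<epsilon> P \<Omega> \<longleftrightarrow>
     \<Omega> \<in> sets P \<and> emeasure P \<Omega> = 1 \<and> (\<forall>t. path_shift t ` \<Omega> = \<Omega>) \<and>
     (\<forall>\<omega>\<in>\<Omega>.
        (\<exists>I. has_rs_integral_minf (\<lambda>s. mexp ((- s / \<epsilon>) *\<^sub>R F)) \<omega> I) \<and>
        (\<exists>I. has_rs_integral_minf (\<lambda>s. mexp ((- s) *\<^sub>R F)) \<omega> I) \<and>
        cadlag (\<lambda>t. eta \<alpha> F \<epsilon> (path_shift t \<omega>)) \<and> sublinear_growth (\<lambda>t. eta \<alpha> F \<epsilon> (path_shift t \<omega>)) \<and>
        cadlag (\<lambda>t. xi F (path_shift t \<omega>)) \<and> sublinear_growth (\<lambda>t. xi F (path_shift t \<omega>)))"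

text \<open>Functions on the negative half-line are represented by functions that are
  \<^const>\<open>undefined\<close> outside it, so that equality is equality on the half-line.\<close>

definition C_minus ::
    "real \<Rightarrow> ((real \<Rightarrow> 'a::real_normed_vector) \<times> (real \<Rightarrow> 'b::real_normed_vector)) set" where
  "C_minus \<beta> = {(\<phi>s, \<phi>f).
     \<phi>s \<in> extensional {..0} \<and> \<phi>f \<in> extensional {..0} \<and>
     continuous_on {..0} \<phi>s \<and> continuous_on {..0} \<phi>f \<and>
     bdd_above ((\<lambda>t. norm (exp (- \<beta> * t) *\<^sub>R \<phi>s t)) ` {..0}) \<and>
     bdd_above ((\<lambda>t. norm (exp (- \<beta> * t) *\<^sub>R \<phi>f t)) ` {..0})}"

text \<open>In the definitions below \<open>z\<close> is the path of the noise. The Bochner integral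
  \<open>LBINT s=0..t\<close> is oriented, that is, for \<open>t \<le> 0\<close> it is minus the integral over
  the interval from \<open>t\<close> to \<open>0\<close>.\<close>

definition hat_solution ::
    "real^'m^'m \<Rightarrow> real^'n^'n \<Rightarrow> (real^'m \<Rightarrow> real^'n \<Rightarrow> real^'m) \<Rightarrow> (real^'m \<Rightarrow> real^'n \<Rightarrow> real^'n) \<Rightarrow>
     real \<Rightarrow> real \<Rightarrow> real \<Rightarrow> (real \<Rightarrow> real^'n) \<Rightarrow> real^'m \<Rightarrow>
     (real \<Rightarrow> real^'m) \<times> (real \<Rightarrow> real^'n) \<Rightarrow> bool" where
  "hat_solution S F g1 g2 \<sigma> \<gamma> \<epsilon> z x0 = (\<lambda>(x, y).
     (x, y) \<in> C_minus (- \<gamma> / \<epsilon>) \<and>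
     (\<forall>t\<le>0.
        x t = mexp (t *\<^sub>R S) *v x0 +
          (LBINT s=0..ereal t. mexp ((t - s) *\<^sub>R S) *v g1 (x s) (y s + \<sigma> *\<^sub>R z s)) \<and>
        y t = (1 / \<epsilon>) *\<^sub>R
          (LBINT s=-\<infinity>..ereal t. mexp (((t - s) / \<epsilon>) *\<^sub>R F) *v g2 (x s) (y s + \<sigma> *\<^sub>R z s))))"

definition tilde_solution ::
    "real^'m^'m \<Rightarrow> real^'n^'n \<Rightarrow> (real^'m \<Rightarrow> real^'n \<Rightarrow> real^'m) \<Rightarrow> (real^'m \<Rightarrow> real^'n \<Rightarrow> real^'n) \<Rightarrow>
     real \<Rightarrow> real \<Rightarrow> real \<Rightarrow> (real \<Rightarrow> real^'n) \<Rightarrow> real^'m \<Rightarrow>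
     (real \<Rightarrow> real^'m) \<times> (real \<Rightarrow> real^'n) \<Rightarrow> bool" where
  "tilde_solution S F g1 g2 \<sigma> \<gamma> \<epsilon> z x0 = (\<lambda>(x, y).
     (x, y) \<in> C_minus (- \<gamma>) \<and>
     (\<forall>t\<le>0.
        x t = mexp ((\<epsilon> * t) *\<^sub>R S) *v x0 + \<epsilon> *\<^sub>R
          (LBINT s=0..ereal t. mexp ((\<epsilon> * (t - s)) *\<^sub>R S) *v g1 (x s) (y s + \<sigma> *\<^sub>R z s)) \<and>
        y t =
          (LBINT s=-\<infinity>..ereal t. mexp ((t - s) *\<^sub>R F) *v g2 (x s) (y s + \<sigma> *\<^sub>R z s))))"

definition hat_h ::
    "real \<Rightarrow> real^'m^'m \<Rightarrow> real^'n^'n \<Rightarrow> (real^'m \<Rightarrow> real^'n \<Rightarrow> real^'m) \<Rightarrow>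
     (real^'m \<Rightarrow> real^'n \<Rightarrow> real^'n) \<Rightarrow> real \<Rightarrow> real \<Rightarrow> real \<Rightarrow> (real \<Rightarrow> real^'n) \<Rightarrow> real^'m \<Rightarrow> real^'n" where
  "hat_h \<alpha> S F g1 g2 \<sigma> \<gamma> \<epsilon> \<omega> x0 =
     (let z = (\<lambda>s. eta \<alpha> F \<epsilon> (path_shift s \<omega>));
          (x, y) = (THE xy. hat_solution S F g1 g2 \<sigma> \<gamma> \<epsilon> z x0 xy)
      in (1 / \<epsilon>) *\<^sub>R
           (LBINT s=-\<infinity>..0. mexp ((- s / \<epsilon>) *\<^sub>R F) *v g2 (x s) (y s + \<sigma> *\<^sub>R z s)))"

definition tilde_h ::
    "real^'m^'m \<Rightarrow> real^'n^'n \<Rightarrow> (real^'m \<Rightarrow> real^'n \<Rightarrow> real^'m) \<Rightarrow>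
     (real^'m \<Rightarrow> real^'n \<Rightarrow> real^'n) \<Rightarrow> real \<Rightarrow> real \<Rightarrow> real \<Rightarrow> (real \<Rightarrow> real^'n) \<Rightarrow> real^'m \<Rightarrow> real^'n" where
  "tilde_h S F g1 g2 \<sigma> \<gamma> \<epsilon> \<omega> x0 =
     (let z = (\<lambda>s. xi F (path_shift s \<omega>));
          (x, y) = (THE xy. tilde_solution S F g1 g2 \<sigma> \<gamma> \<epsilon> z x0 xy)
      in (LBINT s=-\<infinity>..0. mexp ((- s) *\<^sub>R F) *v g2 (x s) (y s + \<sigma> *\<^sub>R z s)))"

definition random_graph :: "('w \<Rightarrow> 'a \<Rightarrow> 'b) \<Rightarrow> 'w \<Rightarrow> ('a \<times> 'b) set" where
  "random_graph h \<omega> = {(x0, h \<omega> x0) | x0. True}"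

definition eq_in_distribution ::
    "'w measure \<Rightarrow> ('w \<Rightarrow> 'b::topological_space) \<Rightarrow> ('w \<Rightarrow> 'b) \<Rightarrow> bool" where
  "eq_in_distribution M X Y \<longleftrightarrow>
     X \<in> borel_measurable M \<and> Y \<in> borel_measurable M \<and> distr M borel X = distr M borel Y"

text \<open>Random graphs are compared fibre by fibre: over each base point the fibres are single
  random points with the same law.\<close>

definition graphs_eq_in_distribution ::
    "'w measure \<Rightarrow> ('w \<Rightarrow> ('a \<times> 'b::topological_space) set) \<Rightarrow> ('w \<Rightarrow> ('a \<times> 'b) set) \<Rightarrow> bool" where
  "graphs_eq_in_distribution M A B \<longleftrightarrow>
     (\<forall>x0. \<exists>X Y. (\<forall>\<omega>\<in>space M. {y. (x0, y) \<in> A \<omega>} = {X \<omega>} \<and> {y. (x0, y) \<in> B \<omega>} = {Y \<omega>}) \<and>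
        eq_in_distribution M X Y)"

end

theory Submission
  imports Defs
begin

text \<open>Let \<open>R \<omega> t = \<epsilon>\<^bsup>-1/\<alpha>\<^esup> \<omega> (\<epsilon> t)\<close>. Substituting \<open>s = \<epsilon> u\<close> in the stochastic integral and in the
  two Lyapunov-Perron equations shows that, path by path, the hat manifold over \<open>\<omega>\<close> is the tilde
  manifold over \<open>R \<omega>\<close>. The height of the tilde manifold is the limit of the Picard iterates,
  hence a functional of the path that is measurable for the product \<open>\<sigma>\<close>-algebra on path space.
  On that \<open>\<sigma>\<close>-algebra \<open>R\<close> preserves the law of the process, because stability and the stationary
  independent increments determine the finite-dimensional distributions. In particular nothing
  has to be known about the Skorokhod topology beyond measurability of the evaluations.\<close>

subsection \<open>Lyapunov-Perron fixed points\<close>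

text \<open>The map \<open>R\<close> need not send the invariant set \<Omega> into itself, so what
  is assumed on \<Omega> says nothing directly about \<open>R \<omega>\<close>; moreover
  \<open>eta\<close>, \<open>xi\<close> and both heights are defined through \<open>THE\<close>,
  which hides their measurability. Hence the common functional is built from \<open>lim\<close> of
  explicit sums and of Picard iterates: it is defined on every path, it is measurable whether or not
  the limits exist, and on \<Omega> it is identified with the tilde height at \<omega> and, after
  \<open>R\<close>, with the hat height. Only the tilde system is solved directly. Its slow equation
  carries the factor \<epsilon>, and under the weight \<open>exp (\<gamma> * t)\<close> the
  Lyapunov-Perron operator contracts by
  \<open>\<epsilon> * K / \<gamma> + K / (\<kappa> - \<gamma>)\<close> with
  \<open>\<kappa> = - \<gamma>f\<close>. The second term is below 1 precisely because
  \<open>K < - (\<gamma> + \<gamma>f)\<close>; the smallness of \<epsilon> is spent on the first.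
  The hat system inherits unique solvability through the time change.\<close>

lemma set_integral_exp_lessThan:
  fixes c t :: real
  assumes "c > 0"
  shows "set_integrable lborel {..<t} (\<lambda>s. exp (c * s))"
    and "(LINT s:{..<t}|lborel. exp (c * s)) = exp (c * t) / c"
proof -
  have lim: "(((\<lambda>s. exp (c * s) / c) \<circ> real_of_ereal) \<longlongrightarrow> 0) (at_right (-\<infinity>))"
    unfolding ereal_tendsto_simps
    using assms by real_asymp
  have lim2: "(((\<lambda>s. exp (c * s) / c) \<circ> real_of_ereal) \<longlongrightarrow> exp (c * t) / c) (at_left (ereal t))"
    unfolding ereal_tendsto_simps using assms by (auto intro!: tendsto_eq_intros)
  have 1: "set_integrable lborel (einterval (-\<infinity>) (ereal t)) (\<lambda>s. exp (c * s))"
    by (rule interval_integral_FTC_nonneg[OF _ _ _ _ lim lim2])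
      (use assms in \<open>auto intro!: derivative_eq_intros\<close>)
  have 2: "(LBINT s=-\<infinity>..ereal t. exp (c * s)) = exp (c * t) / c - 0"
    by (rule interval_integral_FTC_nonneg[OF _ _ _ _ lim lim2])
      (use assms in \<open>auto intro!: derivative_eq_intros\<close>)
  have e: "einterval (-\<infinity>) (ereal t) = {..<t}"
    by (auto simp: einterval_def)
  show "set_integrable lborel {..<t} (\<lambda>s. exp (c * s))"
    using 1 by (simp add: e)
  show "(LINT s:{..<t}|lborel. exp (c * s)) = exp (c * t) / c"
    using 2 by (simp add: e interval_lebesgue_integral_def)
qed

text \<open>The exact value is \<open>(exp (- c * t) - 1) / c\<close>; dropping the 1 leaves a
  multiple of the weight itself, which is the form that can be iterated.\<close>

lemma set_integral_exp_greaterThanLessThan: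
  fixes c t :: real
  assumes "c > 0" "t \<le> 0"
  shows "set_integrable lborel {t<..<0} (\<lambda>s. exp (- c * s))"
    and "(LINT s:{t<..<0}|lborel. exp (- c * s)) \<le> exp (- c * t) / c"
proof -
  have "set_integrable lborel {t..0} (\<lambda>s. exp (- c * s))"
    by (intro borel_integrable_atLeastAtMost' continuous_intros)
  then show i: "set_integrable lborel {t<..<0} (\<lambda>s. exp (- c * s))"
    by (rule set_integrable_subset) auto
  have "(LBINT s=t..0. exp (- c * s)) = - exp (- c * 0) / c - - exp (- c * t) / c"
    unfolding zero_ereal_def
    by (rule interval_integral_FTC_finite)
      (use assms in \<open>auto intro!: continuous_intros derivative_eq_intros
         simp: has_real_derivative_iff_has_vector_derivative[symmetric]\<close>)
  then show "(LINT s:{t<..<0}|lborel. exp (- c * s)) \<le> exp (- c * t) / c"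
    using assms by (simp add: interval_lebesgue_integral_def zero_ereal_def)
qed

text \<open>The Lipschitz condition adds the norms of the two components, while the norm of a
  product type combines them as a Euclidean norm; passing through the latter would cost a factor in
  the contraction constant.\<close>

definition sum_norm :: "'a::real_normed_vector \<times> 'b::real_normed_vector \<Rightarrow> real" where
  "sum_norm v = norm (fst v) + norm (snd v)"

lemma sum_norm_nonneg: "0 \<le> sum_norm v"
  by (simp add: sum_norm_def)

lemma sum_norm_triangle: "sum_norm (u + v) \<le> sum_norm u + sum_norm v"
  unfolding sum_norm_def using norm_triangle_ineq[of "fst u" "fst v"] norm_triangle_ineq[of "snd u" "snd v"]
  by simp

lemma norm_le_sum_norm: "norm v \<le> sum_norm v"
  unfolding sum_norm_def norm_prod_def by (rule sqrt_sum_squares_le_sum) auto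

lemma sum_norm_le_norm: "sum_norm v \<le> 2 * norm v"
  unfolding sum_norm_def using norm_fst_le[of "fst v" "snd v"] norm_snd_le[of "snd v" "fst v"] by simp

lemma continuous_sum_norm: "continuous_on UNIV sum_norm"
  unfolding sum_norm_def by (intro continuous_intros)

text \<open>The excluded value \<open>s = t\<close> is a null set, so this is enough for dominated
  convergence with a moving endpoint.\<close>

lemma indicator_lessThan_tendsto:
  fixes u :: "nat \<Rightarrow> real"
  assumes "u \<longlonglongrightarrow> t" "s \<noteq> t"
  shows "(\<lambda>n. indicator {..<u n} s :: real) \<longlonglongrightarrow> indicator {..<t} s"
proof (cases "s < t")
  case True
  then have "\<forall>\<^sub>F n in sequentially. s < u n" by (rule order_tendstoD[OF assms(1)])
  then show ?thesis using True by (intro tendsto_eventually) (auto elim: eventually_mono)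
next
  case False
  then have "t < s" using assms by simp
  then have "\<forall>\<^sub>F n in sequentially. u n < s" by (rule order_tendstoD[OF assms(1)])
  then show ?thesis using False by (intro tendsto_eventually) (auto elim: eventually_mono)
qed

text \<open>Off the half-line such a function is the constant \<open>undefined\<close>, so
  continuity on the closed half-line suffices.\<close>

lemma borel_measurable_extensional:
  fixes f :: "real \<Rightarrow> 'c::topological_space"
  assumes "f \<in> extensional {..0}" "continuous_on {..0} f"
  shows "f \<in> borel_measurable borel"
proof -
  have "(\<lambda>x. if x \<in> {..0} then f x else undefined) \<in> borel_measurable borel"
    using assms(2) by (intro borel_measurable_continuous_on_if) auto
  also have "(\<lambda>x. if x \<in> {..0} then f x else undefined) = f"
    using assms(1) by (auto simp: extensional_def)
  finally show ?thesis .
qed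

text \<open>An abstract form of the tilde system: \<open>A t\<close> is going to be the exponential
  of \<epsilon>St, \<open>B t\<close> that of Ft, and \<kappa> is \<open>- \<gamma>f\<close>. Of the
  bound on the slow part only non-expansion backwards in time is kept.\<close>

locale lyapunov_perron =
  fixes A :: "real \<Rightarrow> 'a::euclidean_space \<Rightarrow> 'a" and B :: "real \<Rightarrow> 'b::euclidean_space \<Rightarrow> 'b"
    and g1 :: "'a \<times> 'b \<Rightarrow> 'a" and g2 :: "'a \<times> 'b \<Rightarrow> 'b"
    and K \<gamma> \<kappa> \<epsilon> :: real
  assumes linear_A: "\<And>t. linear (A t)" and linear_B: "\<And>t. linear (B t)"
    and cont_A: "continuous_on UNIV (\<lambda>(t, v). A t v)" and cont_B: "continuous_on UNIV (\<lambda>(t, v). B t v)"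
    and bound_A: "\<And>t v. t \<le> 0 \<Longrightarrow> norm (A t v) \<le> norm v"
    and bound_B: "\<And>t v. 0 \<le> t \<Longrightarrow> norm (B t v) \<le> exp (- \<kappa> * t) * norm v"
    and lipschitz_g1: "\<And>u v. norm (g1 u - g1 v) \<le> K * sum_norm (u - v)"
    and lipschitz_g2: "\<And>u v. norm (g2 u - g2 v) \<le> K * sum_norm (u - v)"
    and zero_g1: "g1 0 = 0" and zero_g2: "g2 0 = 0"
    and pos: "0 < K" "0 < \<gamma>" "0 < \<epsilon>" "\<gamma> < \<kappa>"
    and contractive: "\<epsilon> * K / \<gamma> + K / (\<kappa> - \<gamma>) < 1"
begin

definition rate :: real where
  "rate = \<epsilon> * K / \<gamma> + K / (\<kappa> - \<gamma>)"

lemma rate: "0 \<le> rate" "rate < 1"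
  using pos contractive by (auto simp: rate_def)

text \<open>Growth is controlled as in \<open>C_minus (- \<gamma>)\<close> and only on the negative
  half-line. Measurability takes the place of continuity because the noise, which is cadlag, has to
  be covered as well.\<close>

definition admissible :: "(real \<Rightarrow> 'c::real_normed_vector \<times> 'd::real_normed_vector) \<Rightarrow> bool" where
  "admissible p \<longleftrightarrow> p \<in> borel_measurable borel \<and> (\<exists>C. \<forall>t\<le>0. sum_norm (p t) \<le> C * exp (- \<gamma> * t))"

lemma measurable_A [measurable (raw)]:
  assumes [measurable]: "f \<in> borel_measurable M" "h \<in> borel_measurable M"
  shows "(\<lambda>x. A (f x) (h x)) \<in> borel_measurable M"
  using borel_measurable_continuous_on[OF cont_A, of "\<lambda>x. (f x, h x)" M] by simp

lemma measurable_B [measurable (raw)]: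
  assumes [measurable]: "f \<in> borel_measurable M" "h \<in> borel_measurable M"
  shows "(\<lambda>x. B (f x) (h x)) \<in> borel_measurable M"
  using borel_measurable_continuous_on[OF cont_B, of "\<lambda>x. (f x, h x)" M] by simp

lemma continuous_lipschitz:
  fixes g :: "'a \<times> 'b \<Rightarrow> 'c::real_normed_vector"
  assumes "\<And>u v. norm (g u - g v) \<le> K * sum_norm (u - v)"
  shows "continuous_on UNIV g"
proof (rule lipschitz_on_continuous_on)
  show "(2 * K)-lipschitz_on UNIV g"
  proof (rule lipschitz_onI)
    fix u v :: "'a \<times> 'b"
    have "K * sum_norm (u - v) \<le> K * (2 * norm (u - v))"
      using pos sum_norm_le_norm[of "u - v"] by (intro mult_left_mono) auto
    then show "dist (g u) (g v) \<le> 2 * K * dist u v"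
      using assms[of u v] by (simp add: dist_norm)
  qed (use pos in auto)
qed

lemma measurable_g [measurable]: "g1 \<in> borel_measurable borel" "g2 \<in> borel_measurable borel"
  using continuous_lipschitz[OF lipschitz_g1] continuous_lipschitz[OF lipschitz_g2]
  by (auto intro: borel_measurable_continuous_onI)

section \<open>Integral bounds and continuity under the exponential weight\<close>

lemma integral_A:
  assumes [measurable]: "f \<in> borel_measurable borel"
    and bd: "\<And>s. s \<le> 0 \<Longrightarrow> norm (f s) \<le> C * exp (- \<gamma> * s)" and t: "t \<le> 0"
  shows "set_integrable lborel {t<..<0} (\<lambda>s. A (t - s) (f s))"
    and "norm (LINT s:{t<..<0}|lborel. A (t - s) (f s)) \<le> C / \<gamma> * exp (- \<gamma> * t)"
proof -
  note e = set_integral_exp_greaterThanLessThan[OF pos(2) t]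
  have C: "0 \<le> C" using bd[of 0] norm_ge_zero[of "f 0"] by (simp del: norm_ge_zero)
  \<comment> \<open>For s between t and 0 the time \<open>t - s\<close> is negative, so
    \<open>A\<close> does not expand and only the weight is integrated, at the cost of a factor
    \<open>1 / \<gamma>\<close>.\<close>
  have le: "norm (indicator {t<..<0} s *\<^sub>R A (t - s) (f s)) \<le> C * (indicator {t<..<0} s *\<^sub>R exp (- \<gamma> * s))" for s
    using bound_A[of "t - s" "f s"] bd[of s] by (auto split: split_indicator)
  have i: "integrable lborel (\<lambda>s. C * (indicator {t<..<0} s *\<^sub>R exp (- \<gamma> * s)))"
    using e(1) unfolding set_integrable_def by (intro integrable_mult_right) auto
  show s: "set_integrable lborel {t<..<0} (\<lambda>s. A (t - s) (f s))"
    unfolding set_integrable_def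
    by (rule Bochner_Integration.integrable_bound[OF i]) (use le in \<open>auto intro: order.trans[OF _ abs_ge_self]\<close>)
  have "norm (LINT s:{t<..<0}|lborel. A (t - s) (f s)) \<le> (LINT s|lborel. C * (indicator {t<..<0} s *\<^sub>R exp (- \<gamma> * s)))"
    unfolding set_lebesgue_integral_def
    by (rule order.trans[OF integral_norm_bound])
      (intro integral_mono integrable_norm i s[unfolded set_integrable_def] le)
  also have "\<dots> = C * (LINT s:{t<..<0}|lborel. exp (- \<gamma> * s))"
    by (simp add: set_lebesgue_integral_def)
  also have "\<dots> \<le> C * (exp (- \<gamma> * t) / \<gamma>)"
    using C e(2) by (intro mult_left_mono)
  finally show "norm (LINT s:{t<..<0}|lborel. A (t - s) (f s)) \<le> C / \<gamma> * exp (- \<gamma> * t)"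
    by simp
qed

text \<open>The decay \<open>exp (- \<kappa> * (t - s))\<close> beats the growth
  \<open>exp (- \<gamma> * s)\<close> as s tends to minus infinity because \<gamma> < \<kappa>. The
  product integrates to \<open>exp (- \<gamma> * t) / (\<kappa> - \<gamma>)\<close>, again a
  multiple of the weight.\<close>

lemma integral_B:
  assumes [measurable]: "f \<in> borel_measurable borel"
    and bd: "\<And>s. s \<le> 0 \<Longrightarrow> norm (f s) \<le> C * exp (- \<gamma> * s)" and t: "t \<le> 0"
  shows "set_integrable lborel {..<t} (\<lambda>s. B (t - s) (f s))"
    and "norm (LINT s:{..<t}|lborel. B (t - s) (f s)) \<le> C / (\<kappa> - \<gamma>) * exp (- \<gamma> * t)"
proof -
  have "0 < \<kappa> - \<gamma>" using pos by simp
  note e = set_integral_exp_lessThan[OF this, of t]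
  have le: "norm (indicator {..<t} s *\<^sub>R B (t - s) (f s)) \<le>
      (C * exp (- \<kappa> * t)) * (indicator {..<t} s *\<^sub>R exp ((\<kappa> - \<gamma>) * s))" for s
  proof (cases "s < t")
    case True
    have "norm (B (t - s) (f s)) \<le> exp (- \<kappa> * (t - s)) * (C * exp (- \<gamma> * s))"
      using bound_B[of "t - s" "f s"] bd[of s] True t by (auto intro: order.trans mult_left_mono)
    also have "\<dots> = C * exp (- \<kappa> * t) * exp ((\<kappa> - \<gamma>) * s)"
      by (simp add: exp_add[symmetric] algebra_simps flip: exp_add)
    finally show ?thesis using True by simp
  qed auto
  have i: "integrable lborel (\<lambda>s. (C * exp (- \<kappa> * t)) * (indicator {..<t} s *\<^sub>R exp ((\<kappa> - \<gamma>) * s)))"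
    using e(1) unfolding set_integrable_def by (intro integrable_mult_right) auto
  show s: "set_integrable lborel {..<t} (\<lambda>s. B (t - s) (f s))"
    unfolding set_integrable_def
    by (rule Bochner_Integration.integrable_bound[OF i]) (use le in \<open>auto intro: order.trans[OF _ abs_ge_self]\<close>)
  have "norm (LINT s:{..<t}|lborel. B (t - s) (f s)) \<le>
      (LINT s|lborel. (C * exp (- \<kappa> * t)) * (indicator {..<t} s *\<^sub>R exp ((\<kappa> - \<gamma>) * s)))"
    unfolding set_lebesgue_integral_def
    by (rule order.trans[OF integral_norm_bound])
      (intro integral_mono integrable_norm i s[unfolded set_integrable_def] le)
  also have "\<dots> = (C * exp (- \<kappa> * t)) * (LINT s:{..<t}|lborel. exp ((\<kappa> - \<gamma>) * s))"
    by (simp add: set_lebesgue_integral_def)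
  also have "\<dots> = C / (\<kappa> - \<gamma>) * exp (- \<gamma> * t)"
    unfolding e(2) by (simp add: exp_add[symmetric] algebra_simps flip: exp_add)
  finally show "norm (LINT s:{..<t}|lborel. B (t - s) (f s)) \<le> C / (\<kappa> - \<gamma>) * exp (- \<gamma> * t)" .
qed

lemma continuous_A_right: "continuous_on UNIV (\<lambda>t. A t v)"
  using continuous_on_compose2[OF cont_A, of UNIV "\<lambda>t. (t, v)"]
  by (simp add: continuous_on_Pair)

lemma continuous_B_right: "continuous_on UNIV (\<lambda>t. B t v)"
  using continuous_on_compose2[OF cont_B, of UNIV "\<lambda>t. (t, v)"]
  by (simp add: continuous_on_Pair)

text \<open>The time t occurs both in the integrand and in the domain. With the domain absorbed into
  an indicator, dominated convergence along sequences handles both; a convergent sequence of times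
  is bounded by some c, which gives a majorant that does not depend on n.\<close>

lemma continuous_integral_B:
  assumes [measurable]: "f \<in> borel_measurable borel"
    and bd: "\<And>s. s \<le> 0 \<Longrightarrow> norm (f s) \<le> C * exp (- \<gamma> * s)"
  shows "continuous_on {..0} (\<lambda>t. LINT s:{..<t}|lborel. B (t - s) (f s))"
  unfolding continuous_on_sequentially comp_def
proof (intro ballI allI impI, elim conjE)
  fix t :: real and u :: "nat \<Rightarrow> real"
  assume t: "t \<in> {..0}" and u: "\<forall>n. u n \<in> {..0}" "u \<longlonglongrightarrow> t"
  obtain c where c: "\<And>n. norm (u n) \<le> c"
    using convergent_imp_Bseq[OF convergentI[OF u(2)]] by (auto simp: Bseq_def)
  have C: "0 \<le> C" using bd[of 0] norm_ge_zero[of "f 0"] by (simp del: norm_ge_zero)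
  have "0 < \<kappa> - \<gamma>" using pos by simp
  note e = set_integral_exp_lessThan[OF this, of 0]
  show "(\<lambda>n. LINT s:{..<u n}|lborel. B (u n - s) (f s)) \<longlonglongrightarrow> (LINT s:{..<t}|lborel. B (t - s) (f s))"
    unfolding set_lebesgue_integral_def
  proof (rule integral_dominated_convergence)
    show "integrable lborel (\<lambda>s. (C * exp (\<kappa> * c)) * (indicator {..<0} s *\<^sub>R exp ((\<kappa> - \<gamma>) * s)))"
      using e(1) unfolding set_integrable_def by (intro integrable_mult_right) auto
    show "AE s in lborel. (\<lambda>n. indicator {..<u n} s *\<^sub>R B (u n - s) (f s)) \<longlonglongrightarrow>
        indicator {..<t} s *\<^sub>R B (t - s) (f s)"
      using AE_lborel_singleton[of t]
    proof eventually_elim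
      case (elim s)
      have "(\<lambda>n. B (u n - s) (f s)) \<longlonglongrightarrow> B (t - s) (f s)"
        by (rule continuous_on_tendsto_compose[OF continuous_B_right]) (auto intro!: tendsto_intros u)
      then show ?case
        using indicator_lessThan_tendsto[OF u(2) elim] by (intro tendsto_scaleR)
    qed
    fix n
    show "AE s in lborel. norm (indicator {..<u n} s *\<^sub>R B (u n - s) (f s)) \<le>
        (C * exp (\<kappa> * c)) * (indicator {..<0} s *\<^sub>R exp ((\<kappa> - \<gamma>) * s))"
    proof (intro AE_I2)
      fix s
      have un: "- u n \<le> c" "u n \<le> 0" using c[of n] u(1) by auto
      show "norm (indicator {..<u n} s *\<^sub>R B (u n - s) (f s)) \<le>
        (C * exp (\<kappa> * c)) * (indicator {..<0} s *\<^sub>R exp ((\<kappa> - \<gamma>) * s))"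
      proof (cases "s < u n")
        case True
        have "norm (B (u n - s) (f s)) \<le> exp (- \<kappa> * (u n - s)) * (C * exp (- \<gamma> * s))"
          using bound_B[of "u n - s" "f s"] bd[of s] True un by (auto intro: order.trans mult_left_mono)
        also have "\<dots> = C * exp (\<kappa> * (- u n)) * exp ((\<kappa> - \<gamma>) * s)"
          by (simp add: exp_add[symmetric] algebra_simps flip: exp_add)
        also have "\<dots> \<le> C * exp (\<kappa> * c) * exp ((\<kappa> - \<gamma>) * s)"
          using mult_left_mono[OF un(1), of \<kappa>] C pos by (intro mult_right_mono mult_left_mono) auto
        finally show ?thesis using True un by simp
      qed (use C in auto)
    qed
  qed auto
qed

lemma continuous_integral_A:
  assumes [measurable]: "f \<in> borel_measurable borel"
    and bd: "\<And>s. s \<le> 0 \<Longrightarrow> norm (f s) \<le> C * exp (- \<gamma> * s)"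
  shows "continuous_on {..0} (\<lambda>t. LINT s:{t<..<0}|lborel. A (t - s) (f s))"
  unfolding continuous_on_sequentially comp_def
proof (intro ballI allI impI, elim conjE)
  fix t :: real and u :: "nat \<Rightarrow> real"
  assume t: "t \<in> {..0}" and u: "\<forall>n. u n \<in> {..0}" "u \<longlonglongrightarrow> t"
  obtain c where c: "\<And>n. norm (u n) \<le> c" and "c > 0"
    using convergent_imp_Bseq[OF convergentI[OF u(2)]] by (auto simp: Bseq_def)
  have C: "0 \<le> C" using bd[of 0] norm_ge_zero[of "f 0"] by (simp del: norm_ge_zero)
  have "-c \<le> 0" using \<open>c > 0\<close> by simp
  note e = set_integral_exp_greaterThanLessThan[OF pos(2) this]
  show "(\<lambda>n. LINT s:{u n<..<0}|lborel. A (u n - s) (f s)) \<longlonglongrightarrow> (LINT s:{t<..<0}|lborel. A (t - s) (f s))"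
    unfolding set_lebesgue_integral_def
  proof (rule integral_dominated_convergence)
    show "integrable lborel (\<lambda>s. C * (indicator {-c<..<0} s *\<^sub>R exp (- \<gamma> * s)))"
      using e(1) unfolding set_integrable_def by (intro integrable_mult_right) auto
    show "AE s in lborel. (\<lambda>n. indicator {u n<..<0} s *\<^sub>R A (u n - s) (f s)) \<longlonglongrightarrow>
        indicator {t<..<0} s *\<^sub>R A (t - s) (f s)"
      using AE_lborel_singleton[of t]
    proof eventually_elim
      case (elim s)
      have "(\<lambda>n. A (u n - s) (f s)) \<longlonglongrightarrow> A (t - s) (f s)"
        by (rule continuous_on_tendsto_compose[OF continuous_A_right]) (auto intro!: tendsto_intros u)
      moreover have "(\<lambda>n. indicator {u n<..<0} s :: real) \<longlonglongrightarrow> indicator {t<..<0} s"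
      proof -
        \<comment> \<open>Reflecting s to -s turns the moving left endpoint into a moving right
          endpoint, for which convergence is known.\<close>
        have *: "indicator {r<..<0} s = (indicator {..<0} s * indicator {..<-r} (-s) :: real)" for r :: real
          by (auto split: split_indicator)
        show ?thesis unfolding *
          using elim by (intro tendsto_intros indicator_lessThan_tendsto u) auto
      qed
      ultimately show ?case by (intro tendsto_scaleR)
    qed
    fix n
    show "AE s in lborel. norm (indicator {u n<..<0} s *\<^sub>R A (u n - s) (f s)) \<le>
        C * (indicator {-c<..<0} s *\<^sub>R exp (- \<gamma> * s))"
    proof (intro AE_I2)
      fix s
      have un: "- u n \<le> c" "u n \<le> 0" using c[of n] u(1) by auto
      show "norm (indicator {u n<..<0} s *\<^sub>R A (u n - s) (f s)) \<le>
          C * (indicator {-c<..<0} s *\<^sub>R exp (- \<gamma> * s))"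
        using bound_A[of "u n - s" "f s"] bd[of s] un C by (auto split: split_indicator)
    qed
  qed auto
qed

section \<open>The Lyapunov-Perron operator\<close>

definition step ::
    "(real \<Rightarrow> 'a \<times> 'b) \<Rightarrow> 'a \<Rightarrow> (real \<Rightarrow> 'a \<times> 'b) \<Rightarrow> real \<Rightarrow> 'a \<times> 'b" where
  "step w a p t =
     (A t a - \<epsilon> *\<^sub>R (LINT s:{t<..<0}|lborel. A (t - s) (g1 (p s + w s))),
      LINT s:{..<t}|lborel. B (t - s) (g2 (p s + w s)))"

lemma lipschitz_bound:
  fixes g :: "'a \<times> 'b \<Rightarrow> 'c::real_normed_vector"
  assumes g: "\<And>u v. norm (g u - g v) \<le> K * sum_norm (u - v)" "g 0 = 0"
    and p: "\<forall>t\<le>0. sum_norm (p t) \<le> C * exp (- \<gamma> * t)"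
    and w: "\<forall>t\<le>0. sum_norm (w t) \<le> W * exp (- \<gamma> * t)"
    and s: "s \<le> 0"
  shows "norm (g (p s + w s)) \<le> K * (C + W) * exp (- \<gamma> * s)"
proof -
  have "norm (g (p s + w s)) \<le> K * sum_norm (p s + w s)"
    using g(1)[of "p s + w s" 0] g(2) by simp
  also have "\<dots> \<le> K * (C * exp (- \<gamma> * s) + W * exp (- \<gamma> * s))"
    using p w s pos by (intro mult_left_mono order.trans[OF sum_norm_triangle] add_mono) auto
  finally show ?thesis by (simp add: algebra_simps)
qed

text \<open>The term \<open>A t a\<close> cancels in the difference. The integrands then differ by
  at most \<open>K * M * exp (- \<gamma> * s)\<close>, and the two integral bounds contribute the
  two summands of \<open>rate\<close>. Carrying M as a free constant instead of a supremum norm lets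
  the estimate be used directly in inductions on the iterates.\<close>

lemma step_contraction:
  assumes p: "admissible p" and q: "admissible q" and w: "admissible w"
    and M: "\<And>s. s \<le> 0 \<Longrightarrow> sum_norm (p s - q s) \<le> M * exp (- \<gamma> * s)" and t: "t \<le> 0"
  shows "sum_norm (step w a p t - step w a q t) \<le> rate * M * exp (- \<gamma> * t)"
proof -
  have [measurable]: "p \<in> borel_measurable borel" "q \<in> borel_measurable borel" "w \<in> borel_measurable borel"
    using p q w by (auto simp: admissible_def)
  obtain Cp Cq W where C: "\<forall>t\<le>0. sum_norm (p t) \<le> Cp * exp (- \<gamma> * t)"
      "\<forall>t\<le>0. sum_norm (q t) \<le> Cq * exp (- \<gamma> * t)" "\<forall>t\<le>0. sum_norm (w t) \<le> W * exp (- \<gamma> * t)"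
    using p q w by (auto simp: admissible_def)
  have d: "norm (g (p s + w s) - g (q s + w s)) \<le> (K * M) * exp (- \<gamma> * s)"
    if "\<And>u v. norm (g u - g v) \<le> K * sum_norm (u - v)" "s \<le> 0"
    for g :: "'a \<times> 'b \<Rightarrow> 'c::real_normed_vector" and s
    using order.trans[OF that(1)[of "p s + w s" "q s + w s"], of "K * (M * exp (- \<gamma> * s))"]
      mult_left_mono[OF M[OF that(2)], of K] pos
    by (simp add: mult.assoc)
  define D1 where "D1 = (\<lambda>s. g1 (p s + w s) - g1 (q s + w s))"
  define D2 where "D2 = (\<lambda>s. g2 (p s + w s) - g2 (q s + w s))"
  have [measurable]: "D1 \<in> borel_measurable borel" "D2 \<in> borel_measurable borel"
    by (simp_all add: D1_def D2_def)
  have "fst (step w a p t - step w a q t) = - (\<epsilon> *\<^sub>R (LINT s:{t<..<0}|lborel. A (t - s) (D1 s)))"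
    using integral_A(1)[OF _ lipschitz_bound[OF lipschitz_g1 zero_g1 C(1,3)] t]
      integral_A(1)[OF _ lipschitz_bound[OF lipschitz_g1 zero_g1 C(2,3)] t]
    by (simp add: step_def D1_def linear_diff[OF linear_A] set_integral_diff algebra_simps)
  then have "norm (fst (step w a p t - step w a q t)) \<le> \<epsilon> * (K * M / \<gamma> * exp (- \<gamma> * t))"
    using mult_left_mono[OF integral_A(2)[of D1 "K * M" t], of \<epsilon>] d[OF lipschitz_g1] t pos
    by (simp add: D1_def)
  moreover have "snd (step w a p t - step w a q t) = (LINT s:{..<t}|lborel. B (t - s) (D2 s))"
    using integral_B(1)[OF _ lipschitz_bound[OF lipschitz_g2 zero_g2 C(1,3)] t]
      integral_B(1)[OF _ lipschitz_bound[OF lipschitz_g2 zero_g2 C(2,3)] t]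
    by (simp add: step_def D2_def linear_diff[OF linear_B] set_integral_diff)
  then have "norm (snd (step w a p t - step w a q t)) \<le> K * M / (\<kappa> - \<gamma>) * exp (- \<gamma> * t)"
    using integral_B(2)[of D2 "K * M" t] d[OF lipschitz_g2] t by (simp add: D2_def)
  ultimately show ?thesis
    unfolding sum_norm_def rate_def by (simp add: algebra_simps)
qed

text \<open>A parameter integral is measurable in its parameter when the integrand is jointly
  measurable. Therefore \<omega> and t are treated as one variable, and the moving endpoints become
  conditions on the pair of that variable and s.\<close>

lemma measurable_step:
  assumes [measurable]: "(\<lambda>(\<omega>, s). w \<omega> s) \<in> borel_measurable (M \<Otimes>\<^sub>M borel)"
    "(\<lambda>(\<omega>, s). p \<omega> s) \<in> borel_measurable (M \<Otimes>\<^sub>M borel)"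
  shows "(\<lambda>(\<omega>, t). step (w \<omega>) a (p \<omega>) t) \<in> borel_measurable (M \<Otimes>\<^sub>M borel)"
proof -
  have [measurable]: "(\<lambda>x. LINT s|lborel. (if snd x < s \<and> s < 0 then A (snd x - s) (g1 (p (fst x) s + w (fst x) s)) else 0))
      \<in> borel_measurable (M \<Otimes>\<^sub>M borel)"
    by measurable
  have [measurable]: "(\<lambda>x. LINT s|lborel. (if s < snd x then B (snd x - s) (g2 (p (fst x) s + w (fst x) s)) else 0))
      \<in> borel_measurable (M \<Otimes>\<^sub>M borel)"
    by measurable
  have "step (w \<omega>) a (p \<omega>) t =
      (A t a - \<epsilon> *\<^sub>R (LINT s|lborel. (if t < s \<and> s < 0 then A (t - s) (g1 (p \<omega> s + w \<omega> s)) else 0)),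
       LINT s|lborel. (if s < t then B (t - s) (g2 (p \<omega> s + w \<omega> s)) else 0))" for \<omega> t
    unfolding step_def set_lebesgue_integral_def
    by (intro arg_cong2[where f=Pair] arg_cong2[where f=minus] arg_cong2[where f=scaleR] refl
        Bochner_Integration.integral_cong) auto
  then show ?thesis
    unfolding case_prod_beta by simp
qed

lemma measurable_step_path:
  assumes [measurable]: "w \<in> borel_measurable borel" "p \<in> borel_measurable borel"
  shows "step w a p \<in> borel_measurable borel"
proof -
  \<comment> \<open>A dummy real parameter reduces the claim for a fixed path to the joint
    one.\<close>
  have "(\<lambda>(\<omega>, t). step w a p t) \<in> borel_measurable ((borel :: real measure) \<Otimes>\<^sub>M borel)"
    by (rule measurable_step) measurable
  from measurable_compose[OF _ this, of "\<lambda>t. (0, t)" borel] show ?thesis by simp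
qed

lemma admissible_zero: "admissible (\<lambda>_. 0)"
  by (auto simp: admissible_def sum_norm_def intro!: exI[of _ 0])

lemma step_zero_bound:
  assumes w: "admissible w"
  obtains M where "\<And>t. t \<le> 0 \<Longrightarrow> sum_norm (step w a (\<lambda>_. 0) t) \<le> M * exp (- \<gamma> * t)"
proof -
  have [measurable]: "w \<in> borel_measurable borel" using w by (auto simp: admissible_def)
  obtain W where W: "\<forall>t\<le>0. sum_norm (w t) \<le> W * exp (- \<gamma> * t)"
    using w by (auto simp: admissible_def)
  have 0: "\<forall>t\<le>0. sum_norm (0 :: 'a \<times> 'b) \<le> 0 * exp (- \<gamma> * t)" by (simp add: sum_norm_def)
  show thesis
  proof (rule that)
    fix t :: real assume t: "t \<le> 0"
    have "norm (A t a) \<le> norm a" by (rule bound_A[OF t])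
    also have "\<dots> \<le> norm a * exp (- \<gamma> * t)" using t pos by (simp add: mult_le_cancel_left1 mult_le_0_iff)
    finally have "norm (A t a) \<le> norm a * exp (- \<gamma> * t)" .
    moreover have "norm (\<epsilon> *\<^sub>R (LINT s:{t<..<0}|lborel. A (t - s) (g1 (0 + w s)))) \<le> \<epsilon> * (K * (0 + W) / \<gamma> * exp (- \<gamma> * t))"
      using mult_left_mono[OF integral_A(2)[OF _ lipschitz_bound[OF lipschitz_g1 zero_g1 0 W] t], of \<epsilon>] pos by simp
    moreover have "norm (LINT s:{..<t}|lborel. B (t - s) (g2 (0 + w s))) \<le> K * (0 + W) / (\<kappa> - \<gamma>) * exp (- \<gamma> * t)"
      using integral_B(2)[OF _ lipschitz_bound[OF lipschitz_g2 zero_g2 0 W] t] by simp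
    ultimately have "sum_norm (step w a (\<lambda>_. 0) t) \<le> norm a * exp (- \<gamma> * t)
        + \<epsilon> * (K * (0 + W) / \<gamma> * exp (- \<gamma> * t)) + K * (0 + W) / (\<kappa> - \<gamma>) * exp (- \<gamma> * t)"
      unfolding sum_norm_def step_def fst_conv snd_conv
      by (intro add_mono order.trans[OF norm_triangle_ineq4]) auto
    then show "sum_norm (step w a (\<lambda>_. 0) t) \<le> (norm a + \<epsilon> * (K * (0 + W) / \<gamma>) + K * (0 + W) / (\<kappa> - \<gamma>)) * exp (- \<gamma> * t)"
      by (simp add: algebra_simps)
  qed
qed

lemma admissible_step:
  assumes w: "admissible w" and p: "admissible p"
  shows "admissible (step w a p)"
proof -
  have [measurable]: "w \<in> borel_measurable borel" "p \<in> borel_measurable borel"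
    using w p by (auto simp: admissible_def)
  obtain C where C: "\<And>t. t \<le> 0 \<Longrightarrow> sum_norm (p t) \<le> C * exp (- \<gamma> * t)"
    using p by (auto simp: admissible_def)
  obtain M where M: "\<And>t. t \<le> 0 \<Longrightarrow> sum_norm (step w a (\<lambda>_. 0) t) \<le> M * exp (- \<gamma> * t)"
    using step_zero_bound[OF w] by blast
  \<comment> \<open>The operator is affine-like: its value at p is compared with its value at the
    zero path, whose size M is known.\<close>
  have "sum_norm (step w a p t) \<le> (rate * C + M) * exp (- \<gamma> * t)" if "t \<le> 0" for t
    using step_contraction[OF p admissible_zero w, of C t a] C that M[OF that]
      sum_norm_triangle[of "step w a p t - step w a (\<lambda>_. 0) t" "step w a (\<lambda>_. 0) t"]
    by (simp add: algebra_simps)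
  then show ?thesis by (auto simp: admissible_def intro!: measurable_step_path)
qed

section \<open>Picard iteration\<close>

definition picard :: "(real \<Rightarrow> 'a \<times> 'b) \<Rightarrow> 'a \<Rightarrow> nat \<Rightarrow> real \<Rightarrow> 'a \<times> 'b" where
  "picard w a k = (step w a ^^ k) (\<lambda>_. 0)"

lemma picard_0 [simp]: "picard w a 0 = (\<lambda>_. 0)"
  and picard_Suc [simp]: "picard w a (Suc k) = step w a (picard w a k)"
  by (simp_all add: picard_def)

lemma admissible_picard: "admissible w \<Longrightarrow> admissible (picard w a k)"
  by (induction k) (auto intro: admissible_zero admissible_step)

lemma measurable_picard:
  assumes "(\<lambda>(\<omega>, s). w \<omega> s) \<in> borel_measurable (M \<Otimes>\<^sub>M borel)"
  shows "(\<lambda>(\<omega>, t). picard (w \<omega>) a k t) \<in> borel_measurable (M \<Otimes>\<^sub>M borel)"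
  by (induction k) (auto intro: measurable_step[OF assms])

text \<open>The iteration starts at zero, so the initial error is p itself, and each step multiplies
  the weighted error by \<open>rate\<close>. This yields uniqueness of fixed points on the
  half-line, and it exhibits a fixed point as a limit of quantities that are measurable in the
  noise.\<close>

lemma picard_tendsto_fixpoint:
  assumes w: "admissible w" and p: "admissible p"
    and fp: "\<And>t. t \<le> 0 \<Longrightarrow> p t = step w a p t" and t: "t \<le> 0"
  shows "(\<lambda>k. picard w a k t) \<longlonglongrightarrow> p t"
proof -
  obtain C where C: "\<And>t. t \<le> 0 \<Longrightarrow> sum_norm (p t) \<le> C * exp (- \<gamma> * t)"
    using p by (auto simp: admissible_def)
  have bd: "sum_norm (picard w a k s - p s) \<le> (rate ^ k * C) * exp (- \<gamma> * s)" if "s \<le> 0" for k s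
    using that
  proof (induction k arbitrary: s)
    case 0
    then show ?case using C[of s] by (simp add: sum_norm_def)
  next
    case (Suc k)
    show ?case
      using step_contraction[OF admissible_picard[OF w, of a k] p w Suc.IH Suc.prems, of a] fp[OF Suc.prems]
      by (simp add: mult.assoc)
  qed
  have "(\<lambda>k. rate ^ k * C * exp (- \<gamma> * t)) \<longlonglongrightarrow> 0 * C * exp (- \<gamma> * t)"
    using rate by (intro tendsto_intros LIMSEQ_power_zero) auto
  then have "(\<lambda>k. rate ^ k * C * exp (- \<gamma> * t)) \<longlonglongrightarrow> 0" by simp
  then have "(\<lambda>k. picard w a k t - p t) \<longlonglongrightarrow> 0"
    by (rule Lim_null_comparison[rotated])
      (use bd[OF t] in \<open>auto intro!: always_eventually order.trans[OF norm_le_sum_norm]\<close>)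
  then show ?thesis by (simp add: LIM_zero_iff)
qed

text \<open>Banach's argument carried out pointwise: at each t \<le> 0 the iterates form a Cauchy
  sequence, with an error that is geometric up to the weight
  \<open>exp (- \<gamma> * t)\<close>.\<close>

lemma fixpoint_exists:
  assumes w: "admissible w"
  obtains p where "admissible p" "\<And>t. t \<le> 0 \<Longrightarrow> p t = step w a p t"
proof -
  obtain M where M: "\<And>t. t \<le> 0 \<Longrightarrow> sum_norm (step w a (\<lambda>_. 0) t) \<le> M * exp (- \<gamma> * t)"
    using step_zero_bound[OF w] by blast
  \<comment> \<open>This is M times the sum of the geometric series. Being a solution of
    \<open>rate * M' + M = M'\<close>, it is a bound that one further iteration reproduces.\<close>
  define M' where "M' = M / (1 - rate)"
  have M': "rate * M' + M = M'" using rate by (simp add: M'_def field_simps)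
  have bd: "sum_norm (picard w a m t) \<le> M' * exp (- \<gamma> * t)" if "t \<le> 0" for m t
    using that
  proof (induction m arbitrary: t)
    case 0
    have "0 \<le> M" using M[of 0] sum_norm_nonneg[of "step w a (\<lambda>_. 0) 0"] by simp
    then show ?case using rate by (simp add: sum_norm_def M'_def)
  next
    case (Suc m)
    have "sum_norm (picard w a (Suc m) t) \<le> rate * M' * exp (- \<gamma> * t) + M * exp (- \<gamma> * t)"
      using step_contraction[OF admissible_picard[OF w, of a m] admissible_zero w, of M' t a] Suc M[OF Suc.prems]
        sum_norm_triangle[of "step w a (picard w a m) t - step w a (\<lambda>_. 0) t" "step w a (\<lambda>_. 0) t"]
      by simp
    then show ?case unfolding distrib_right[symmetric] M' .
  qed
  have diff: "sum_norm (picard w a (k + m) t - picard w a k t) \<le> (rate ^ k * M') * exp (- \<gamma> * t)"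
    if "t \<le> 0" for k m t
    using that
  proof (induction k arbitrary: t)
    case 0
    then show ?case using bd by simp
  next
    case (Suc k)
    show ?case
      using step_contraction[OF admissible_picard[OF w, of a "k + m"] admissible_picard[OF w, of a k] w Suc.IH Suc.prems, of a]
      by (simp add: mult.assoc)
  qed
  have null: "(\<lambda>k. rate ^ k * M' * exp (- \<gamma> * t)) \<longlonglongrightarrow> 0" for t
    using tendsto_mult_right[OF LIMSEQ_power_zero[of rate], of "M' * exp (- \<gamma> * t)"] rate
    by (simp add: mult.assoc)
  \<comment> \<open>No convergence is claimed for t > 0. There \<open>lim\<close> may be arbitrary,
    yet p stays measurable on the whole line.\<close>
  define p where "p = (\<lambda>t. lim (\<lambda>k. picard w a k t))"
  have lim: "(\<lambda>k. picard w a k t) \<longlonglongrightarrow> p t" if t: "t \<le> 0" for t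
  proof -
    have "Cauchy (\<lambda>k. picard w a k t)"
    proof (rule CauchyI')
      fix e :: real assume "e > 0"
      then obtain N where N: "\<And>k. k \<ge> N \<Longrightarrow> rate ^ k * M' * exp (- \<gamma> * t) < e"
        using order_tendstoD(2)[OF null, of e] by (auto simp: eventually_sequentially)
      have "norm (picard w a k t - picard w a n t) < e" if "N \<le> k" "k < n" for k n
      proof -
        have "sum_norm (picard w a (k + (n - k)) t - picard w a k t) < e"
          using diff[OF t, of k "n - k"] N[OF that(1)] by simp
        then show ?thesis
          using that norm_le_sum_norm[of "picard w a n t - picard w a k t"]
          by (simp add: norm_minus_commute)
      qed
      then show "\<exists>M. \<forall>m\<ge>M. \<forall>n>m. dist (picard w a m t) (picard w a n t) < e"
        by (auto simp: dist_norm)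
    qed
    then show ?thesis unfolding p_def by (simp add: Cauchy_convergent_iff convergent_LIMSEQ_iff)
  qed
  have est: "sum_norm (p t - picard w a k t) \<le> (rate ^ k * M') * exp (- \<gamma> * t)" if t: "t \<le> 0" for k t
  proof -
    have "(\<lambda>m. picard w a (m + k) t) \<longlonglongrightarrow> p t"
      using LIMSEQ_ignore_initial_segment[OF lim[OF t], of k] .
    then have "(\<lambda>m. sum_norm (picard w a (m + k) t - picard w a k t)) \<longlonglongrightarrow> sum_norm (p t - picard w a k t)"
      by (intro continuous_on_tendsto_compose[OF continuous_sum_norm] tendsto_intros) auto
    then show ?thesis
      by (rule LIMSEQ_le_const2) (use diff[OF t, of k] in \<open>auto simp: add.commute\<close>)
  qed
  have [measurable]: "picard w a k \<in> borel_measurable borel" for k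
    using admissible_picard[OF w] by (auto simp: admissible_def)
  have p: "admissible p"
    unfolding admissible_def
  proof
    show "p \<in> borel_measurable borel" unfolding p_def by measurable
    show "\<exists>C. \<forall>t\<le>0. sum_norm (p t) \<le> C * exp (- \<gamma> * t)"
      using est[of _ 0] by (intro exI[of _ M']) simp
  qed
  have "p t = step w a p t" if t: "t \<le> 0" for t
  proof (rule LIMSEQ_unique)
    show "(\<lambda>k. picard w a (Suc k) t) \<longlonglongrightarrow> p t"
      using LIMSEQ_Suc[OF lim[OF t]] .
    \<comment> \<open>Contraction carries the error estimate for the k-th iterate over to the images
      under \<open>step\<close>; both sides of the fixed point equation are thus limits of the same
      shifted sequence.\<close>
    have "(\<lambda>k. step w a p t - picard w a (Suc k) t) \<longlonglongrightarrow> 0"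
    proof (rule Lim_null_comparison[OF always_eventually])
      show "\<forall>k. norm (step w a p t - picard w a (Suc k) t) \<le> rate * (rate ^ k * M') * exp (- \<gamma> * t)"
        using step_contraction[OF p admissible_picard[OF w] w est t] 
        by (auto intro: order.trans[OF norm_le_sum_norm])
      show "(\<lambda>k. rate * (rate ^ k * M') * exp (- \<gamma> * t)) \<longlonglongrightarrow> 0"
        using tendsto_mult_right_zero[OF null, of rate t] by (simp add: mult.assoc)
    qed
    from tendsto_diff[OF tendsto_const[of "step w a p t"] this]
    show "(\<lambda>k. picard w a (Suc k) t) \<longlonglongrightarrow> step w a p t" by simp
  qed
  with p show thesis by (rule that)
qed

section \<open>Unique solvability in the weighted space\<close>

definition solution :: "(real \<Rightarrow> 'a \<times> 'b) \<Rightarrow> 'a \<Rightarrow> (real \<Rightarrow> 'a) \<times> (real \<Rightarrow> 'b) \<Rightarrow> bool" where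
  "solution w a = (\<lambda>(x, y). (x, y) \<in> C_minus (- \<gamma>) \<and> (\<forall>t\<le>0. (x t, y t) = step w a (\<lambda>s. (x s, y s)) t))"

lemma solution_admissible:
  assumes "solution w a (x, y)"
  shows "admissible (\<lambda>s. (x s, y s))"
proof -
  have C: "(x, y) \<in> C_minus (- \<gamma>)" using assms by (simp add: solution_def)
  have [measurable]: "x \<in> borel_measurable borel" "y \<in> borel_measurable borel"
    using C by (auto simp: C_minus_def intro!: borel_measurable_extensional)
  obtain C1 C2 where C12: "\<And>t. t \<le> 0 \<Longrightarrow> norm (exp (\<gamma> * t) *\<^sub>R x t) \<le> C1"
      "\<And>t. t \<le> 0 \<Longrightarrow> norm (exp (\<gamma> * t) *\<^sub>R y t) \<le> C2"
    using C by (auto simp: C_minus_def bdd_above_def)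
  have "sum_norm (x t, y t) \<le> (C1 + C2) * exp (- \<gamma> * t)" if "t \<le> 0" for t
  proof -
    have "sum_norm (x t, y t) = (exp (\<gamma> * t) * norm (x t) + exp (\<gamma> * t) * norm (y t)) * exp (- \<gamma> * t)"
      by (simp add: sum_norm_def distrib_right mult.assoc flip: exp_add)
        (simp add: mult.left_commute mult.commute flip: exp_add)
    also have "\<dots> \<le> (C1 + C2) * exp (- \<gamma> * t)"
      using C12[OF that] by (intro mult_right_mono add_mono) auto
    finally show ?thesis .
  qed
  then show ?thesis by (auto simp: admissible_def)
qed

lemma picard_tendsto_solution:
  assumes "admissible w" "solution w a (x, y)" "t \<le> 0"
  shows "(\<lambda>k. picard w a k t) \<longlonglongrightarrow> (x t, y t)"
  using assms by (intro picard_tendsto_fixpoint solution_admissible) (auto simp: solution_def)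

lemma continuous_step:
  assumes w: "admissible w" and p: "admissible p"
  shows "continuous_on {..0} (step w a p)"
proof -
  have [measurable]: "w \<in> borel_measurable borel" "p \<in> borel_measurable borel"
    using w p by (auto simp: admissible_def)
  obtain C W where C: "\<forall>t\<le>0. sum_norm (p t) \<le> C * exp (- \<gamma> * t)" "\<forall>t\<le>0. sum_norm (w t) \<le> W * exp (- \<gamma> * t)"
    using w p by (auto simp: admissible_def)
  show ?thesis
    unfolding step_def
    by (intro continuous_intros continuous_on_subset[OF continuous_A_right]
        continuous_integral_A[OF _ lipschitz_bound[OF lipschitz_g1 zero_g1 C]]
        continuous_integral_B[OF _ lipschitz_bound[OF lipschitz_g2 zero_g2 C]]) auto
qed

text \<open>For t \<le> 0 both integrals see negative times only, so a fixed point survives being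
  cut off to the half-line.\<close>

lemma step_cong:
  assumes "t \<le> 0" "\<And>s. s \<le> 0 \<Longrightarrow> p s = q s"
  shows "step w a p t = step w a q t"
  unfolding step_def using assms
  by (auto intro!: set_lebesgue_integral_cong)

text \<open>A fixed point is continuous because it lies in the image of \<open>step\<close>;
  restricting it to the half-line puts it into \<open>C_minus\<close>. Two solutions agree there as
  limits of the same Picard sequence, and extensionality makes them equal as functions.\<close>

lemma ex1_solution:
  assumes w: "admissible w"
  shows "\<exists>!xy. solution w a xy"
proof (rule ex_ex1I)
  obtain p where p: "admissible p" and fp: "\<And>t. t \<le> 0 \<Longrightarrow> p t = step w a p t"
    using fixpoint_exists[OF w] by blast
  obtain C where C: "\<And>t. t \<le> 0 \<Longrightarrow> sum_norm (p t) \<le> C * exp (- \<gamma> * t)"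
    using p by (auto simp: admissible_def)
  define x where "x = restrict (\<lambda>t. fst (p t)) {..0}"
  define y where "y = restrict (\<lambda>t. snd (p t)) {..0}"
  have "continuous_on {..0} p"
    using continuous_step[OF w p, of a] fp continuous_on_cong[of "{..0}" "{..0}" p "step w a p"] by auto
  then have "continuous_on {..0} (\<lambda>t. fst (p t))" "continuous_on {..0} (\<lambda>t. snd (p t))"
    by (auto intro!: continuous_intros)
  then have "continuous_on {..0} x" "continuous_on {..0} y"
    by (auto simp: x_def y_def elim!: continuous_on_eq)
  moreover have bd: "exp (\<gamma> * t) * r \<le> C" if "t \<le> 0" "r \<le> sum_norm (p t)" for r t
  proof -
    have "exp (\<gamma> * t) * r \<le> exp (\<gamma> * t) * (C * exp (- \<gamma> * t))"
      using that C[OF that(1)] by auto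
    also have "\<dots> = C" by (simp add: mult.left_commute flip: exp_add)
    finally show ?thesis .
  qed
  have "bdd_above ((\<lambda>t. norm (exp (- (- \<gamma>) * t) *\<^sub>R x t)) ` {..0})"
    "bdd_above ((\<lambda>t. norm (exp (- (- \<gamma>) * t) *\<^sub>R y t)) ` {..0})"
    using bd by (auto intro!: bdd_aboveI2[where M=C] simp: x_def y_def sum_norm_def)
  ultimately have "(x, y) \<in> C_minus (- \<gamma>)"
    by (simp add: C_minus_def x_def y_def)
  moreover have "(x t, y t) = step w a (\<lambda>s. (x s, y s)) t" if "t \<le> 0" for t
  proof -
    have "(x t, y t) = p t" using that by (simp add: x_def y_def)
    also have "\<dots> = step w a (\<lambda>s. (x s, y s)) t"
      unfolding fp[OF that] by (rule step_cong[OF that]) (simp add: x_def y_def)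
    finally show ?thesis .
  qed
  ultimately show "\<exists>xy. solution w a xy"
    by (auto simp: solution_def)
next
  fix xy xy' assume s: "solution w a xy" "solution w a xy'"
  obtain x y x' y' where [simp]: "xy = (x, y)" "xy' = (x', y')" by (cases xy, cases xy') auto
  have eq: "(x t, y t) = (x' t, y' t)" if "t \<le> 0" for t
    using picard_tendsto_solution[OF w, of a x y t] picard_tendsto_solution[OF w, of a x' y' t] s that
    by (intro LIMSEQ_unique) auto
  have e: "x \<in> extensional {..0}" "x' \<in> extensional {..0}" "y \<in> extensional {..0}" "y' \<in> extensional {..0}"
    using s by (auto simp: solution_def C_minus_def)
  have "x = x'" by (rule extensionalityI[OF e(1,2)]) (use eq in auto)
  moreover have "y = y'" by (rule extensionalityI[OF e(3,4)]) (use eq in auto)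
  ultimately show "xy = xy'" by simp
qed

end

subsection \<open>The matrix exponential\<close>

lemma funpow_matrix_mult_scaleR:
  fixes A :: "real^'n^'n"
  shows "((\<lambda>B. (t *\<^sub>R A) ** B) ^^ k) (mat 1) = t ^ k *\<^sub>R ((\<lambda>B. A ** B) ^^ k) (mat 1)"
  by (induction k) (simp_all add: scalar_matrix_assoc[symmetric] matrix_scalar_ac)

text \<open>Left multiplication by \<open>A\<close> is a linear map of a finite-dimensional space
  and hence bounded; iterating its bound c takes the place of submultiplicativity of the
  norm.\<close>

lemma norm_funpow_matrix_mult_le:
  fixes A :: "real^'n^'n"
  obtains c where "0 \<le> c" "\<And>k. norm (((\<lambda>B. A ** B) ^^ k) (mat 1)) \<le> c ^ k * norm (mat 1 :: real^'n^'n)"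
proof -
  have lin: "linear (\<lambda>B :: real^'n^'n. A ** B)"
    by (rule linearI) (simp_all add: matrix_add_ldistrib matrix_scalar_ac scalar_matrix_assoc[symmetric])
  obtain c where c: "0 < c" "\<And>B :: real^'n^'n. norm (A ** B) \<le> c * norm B"
    using linear_bounded_pos[OF lin] by (auto simp: mult.commute)
  have "norm (((\<lambda>B. A ** B) ^^ k) (mat 1)) \<le> c ^ k * norm (mat 1 :: real^'n^'n)" for k
  proof (induction k)
    case (Suc k)
    have "norm (A ** ((\<lambda>B. A ** B) ^^ k) (mat 1)) \<le> c * (c ^ k * norm (mat 1 :: real^'n^'n))"
      using c(1) Suc by (intro order.trans[OF c(2)] mult_left_mono) auto
    then show ?case by simp
  qed simp
  with c show thesis by (intro that[of c]) auto
qed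

text \<open>The powers of t factor out, leaving a power series in t with matrix coefficients. On
  each ball of radius R it is dominated by the exponential series at \<open>R * c\<close>, and
  continuity is local.\<close>

lemma continuous_mexp:
  fixes A :: "real^'n^'n"
  shows "continuous_on UNIV (\<lambda>t. mexp (t *\<^sub>R A))"
proof -
  obtain c where c: "0 \<le> c" "\<And>k. norm (((\<lambda>B. A ** B) ^^ k) (mat 1)) \<le> c ^ k * norm (mat 1 :: real^'n^'n)"
    using norm_funpow_matrix_mult_le by blast
  let ?f = "\<lambda>k t. (t ^ k / fact k) *\<^sub>R ((\<lambda>B. A ** B) ^^ k) (mat 1)"
  have eq: "mexp (t *\<^sub>R A) = (\<Sum>k. ?f k t)" for t
    unfolding mexp_def funpow_matrix_mult_scaleR by simp
  have "continuous_on (ball 0 R) (\<lambda>t. \<Sum>k. ?f k t)" for R :: real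
  proof (rule uniform_limit_theorem)
    show "uniform_limit (ball 0 R) (\<lambda>n t. \<Sum>k<n. ?f k t) (\<lambda>t. \<Sum>k. ?f k t) sequentially"
    proof (rule Weierstrass_m_test)
      fix k :: nat and t :: real assume "t \<in> ball 0 R"
      then have "\<bar>t\<bar> ^ k \<le> R ^ k" by (intro power_mono) auto
      then have "norm (?f k t) \<le> (R ^ k / fact k) * (c ^ k * norm (mat 1 :: real^'n^'n))"
        using c \<open>t \<in> ball 0 R\<close> by (auto simp: power_abs divide_right_mono intro!: mult_mono divide_right_mono zero_le_power)
      also have "\<dots> = (R * c) ^ k /\<^sub>R fact k * norm (mat 1 :: real^'n^'n)"
        by (simp add: power_mult_distrib divide_simps)
      finally show "norm (?f k t) \<le> (R * c) ^ k /\<^sub>R fact k * norm (mat 1 :: real^'n^'n)" .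
    next
      show "summable (\<lambda>k. (R * c) ^ k /\<^sub>R fact k * norm (mat 1 :: real^'n^'n))"
        by (intro summable_mult2 summable_exp_generic)
    qed
  qed (auto intro!: always_eventually continuous_intros)
  then have "continuous_on (\<Union>R. ball 0 R) (\<lambda>t. \<Sum>k. ?f k t)"
    by (intro continuous_on_open_UN) auto
  moreover have "(\<Union>R. ball (0::real) R) = UNIV"
    by (auto intro: gt_ex)
  ultimately show ?thesis unfolding eq by simp
qed

lemma bounded_bilinear_matrix_vector_mult:
  "bounded_bilinear ((*v) :: real^'n^'m \<Rightarrow> real^'n \<Rightarrow> real^'m)"
  unfolding bilinear_conv_bounded_bilinear[symmetric] bilinear_def
  by (auto intro!: linearI simp: matrix_vector_right_distrib matrix_vector_mult_add_rdistrib
      matrix_vector_mult_scaleR scaleR_matrix_vector_assoc)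

lemma continuous_mexp_mult:
  fixes A :: "real^'n^'n"
  assumes "continuous_on UNIV f"
  shows "continuous_on UNIV (\<lambda>(t, v). mexp (f t *\<^sub>R A) *v v)"
  unfolding case_prod_beta
  by (intro bounded_bilinear.continuous_on[OF bounded_bilinear_matrix_vector_mult]
      continuous_on_compose2[OF continuous_mexp] continuous_on_compose2[OF assms] continuous_intros) auto

subsection \<open>Cadlag paths\<close>

text \<open>Only countably many values of the path enter, so that this is jointly measurable in the path
  and the time even with respect to the product \<open>\<sigma>\<close>-algebra; for a cadlag path it is evaluation.\<close>

definition path_eval :: "(real \<Rightarrow> 'b::banach) \<Rightarrow> real \<Rightarrow> 'b" where
  "path_eval \<omega> s = lim (\<lambda>k. \<omega> (real_of_int (\<lfloor>real (Suc k) * s\<rfloor> + 1) / real (Suc k)))"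

text \<open>The next grid point of mesh \<open>1 / Suc k\<close> strictly to the right of s.
  Strictness matters: the values of a cadlag path are recovered through the filter
  \<open>at_right s\<close>.\<close>

lemma right_approx_tendsto:
  fixes s :: real
  shows "(\<lambda>k. real_of_int (\<lfloor>real (Suc k) * s\<rfloor> + 1) / real (Suc k)) \<longlonglongrightarrow> s"
    and "s < real_of_int (\<lfloor>real (Suc k) * s\<rfloor> + 1) / real (Suc k)"
proof -
  have gt: "s < real_of_int (\<lfloor>real (Suc k) * s\<rfloor> + 1) / real (Suc k)" for k
    using floor_correct[of "real (Suc k) * s"] by (simp add: pos_less_divide_eq mult.commute del: of_nat_Suc)
  have le: "real_of_int (\<lfloor>real (Suc k) * s\<rfloor> + 1) / real (Suc k) \<le> s + 1 / real (Suc k)" for k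
  proof -
    have "real_of_int (\<lfloor>real (Suc k) * s\<rfloor> + 1) / real (Suc k) \<le> (real (Suc k) * s + 1) / real (Suc k)"
      using floor_correct[of "real (Suc k) * s"] by (intro divide_right_mono) auto
    then show ?thesis by (simp add: add_divide_distrib del: of_nat_Suc)
  qed
  have lim: "(\<lambda>k. s + 1 / real (Suc k)) \<longlonglongrightarrow> s"
    using tendsto_add[OF tendsto_const LIMSEQ_inverse_real_of_nat, of s] by (simp add: inverse_eq_divide)
  show "(\<lambda>k. real_of_int (\<lfloor>real (Suc k) * s\<rfloor> + 1) / real (Suc k)) \<longlonglongrightarrow> s"
    by (rule tendsto_sandwich[OF _ _ tendsto_const lim])
      (use gt le in \<open>auto intro!: always_eventually less_imp_le simp del: of_nat_Suc\<close>)
  show "s < real_of_int (\<lfloor>real (Suc k) * s\<rfloor> + 1) / real (Suc k)" by (rule gt)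
qed

lemma path_eval_cadlag:
  assumes "cadlag \<omega>"
  shows "path_eval \<omega> = \<omega>"
proof
  fix s
  have "filterlim (\<lambda>k. real_of_int (\<lfloor>real (Suc k) * s\<rfloor> + 1) / real (Suc k)) (at_right s) sequentially"
    unfolding filterlim_at
    using right_approx_tendsto(1)[of s] less_imp_neq[OF right_approx_tendsto(2)[of s], symmetric]
      right_approx_tendsto(2)[of s]
    by (intro conjI always_eventually allI) auto
  then have "(\<lambda>k. \<omega> (real_of_int (\<lfloor>real (Suc k) * s\<rfloor> + 1) / real (Suc k))) \<longlonglongrightarrow> \<omega> s"
    using assms unfolding cadlag_def by (auto intro: filterlim_compose)
  then show "path_eval \<omega> s = \<omega> s" unfolding path_eval_def by (rule limI)
qed

text \<open>Evaluation at a random time. The grid index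
  \<open>\<lfloor>real (Suc k) * h x\<rfloor>\<close> takes countably many values, so every
  approximant splits into countably many evaluations at fixed times.\<close>

lemma measurable_path_eval:
  assumes [measurable]: "\<And>t. (\<lambda>x. X x t) \<in> borel_measurable M"
    and h[measurable]: "h \<in> borel_measurable M"
  shows "(\<lambda>x. path_eval (X x) (h x) :: 'b::{banach, second_countable_topology}) \<in> borel_measurable M"
proof -
  have "(\<lambda>x. X x (real_of_int (\<lfloor>real (Suc k) * h x\<rfloor> + 1) / real (Suc k))) \<in> borel_measurable M" for k
  proof (rule measurable_compose_countable[where g="\<lambda>x. \<lfloor>real (Suc k) * h x\<rfloor>"
        and f="\<lambda>i x. X x (real_of_int (i + 1) / real (Suc k))"])
    show "(\<lambda>x. X x (real_of_int (i + 1) / real (Suc k))) \<in> borel_measurable M" for i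
      by measurable
    show "(\<lambda>x. \<lfloor>real (Suc k) * h x\<rfloor>) \<in> M \<rightarrow>\<^sub>M count_space UNIV"
      by measurable
  qed
  then show ?thesis unfolding path_eval_def by measurable
qed

lemma borel_measurable_cadlag:
  fixes f :: "real \<Rightarrow> 'b::{banach, second_countable_topology}"
  assumes "cadlag f"
  shows "f \<in> borel_measurable borel"
  using measurable_path_eval[of "\<lambda>_. f" borel "\<lambda>s. s"] by (simp add: path_eval_cadlag[OF assms])

text \<open>The one-sided limits bound f on a punctured neighbourhood of each point and the value
  there bounds it at the point; compactness leaves finitely many such neighbourhoods.\<close>

lemma cadlag_locally_bounded:
  fixes f :: "real \<Rightarrow> 'b::real_normed_vector"
  assumes "cadlag f"
  obtains C where "\<And>t. t \<in> {a..b} \<Longrightarrow> norm (f t) \<le> C"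
proof -
  have nb: "\<exists>U C. open U \<and> t \<in> U \<and> (\<forall>s\<in>U. norm (f s) \<le> C)" for t
  proof -
    obtain l where r: "(f \<longlongrightarrow> f t) (at_right t)" and l: "(f \<longlongrightarrow> l) (at_left t)"
      using assms by (auto simp: cadlag_def)
    have "\<forall>\<^sub>F s in at_right t. norm (f s) < norm (f t) + 1"
      using tendsto_norm[OF r] by (rule order_tendstoD) simp
    moreover have "\<forall>\<^sub>F s in at_left t. norm (f s) < norm l + 1"
      using tendsto_norm[OF l] by (rule order_tendstoD) simp
    ultimately have "\<forall>\<^sub>F s in at t. norm (f s) \<le> norm (f t) + norm l + 1"
      unfolding eventually_at_split by (auto elim!: eventually_mono intro: order.trans[OF less_imp_le])
    then obtain U where U: "open U" "t \<in> U" "\<forall>s\<in>U. s \<noteq> t \<longrightarrow> norm (f s) \<le> norm (f t) + norm l + 1"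
      unfolding eventually_at_topological by blast
    have "norm (f s) \<le> norm (f t) + norm l + 1" if "s \<in> U" for s
      using U(3) that by (cases "s = t") auto
    with U show ?thesis by blast
  qed
  then obtain U C where UC: "\<And>t. open (U t)" "\<And>t. t \<in> U t" "\<And>t s. s \<in> U t \<Longrightarrow> norm (f s) \<le> C t"
    by metis
  have "compact {a..b}" by simp
  then obtain T where T: "finite T" "{a..b} \<subseteq> (\<Union>t\<in>T. U t)"
    using compactE_image[of "{a..b}" "{a..b}" U] UC by (metis UN_iff subsetI)
  have "norm (f s) \<le> Max (C ` T)" if s: "s \<in> {a..b}" for s
  proof -
    obtain t where "t \<in> T" "s \<in> U t" using T(2) s by blast
    then show ?thesis using UC(3)[of s t] T by (auto intro: order.trans)
  qed
  then show thesis by (rule that)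
qed

text \<open>Far out \<open>norm (f t)\<close> is at most \<open>- t\<close>, which is at most
  \<open>exp (- \<gamma> * t) / \<gamma>\<close> because \<open>1 + x \<le> exp x\<close>. The
  remaining compact interval contributes the bound D; hence the constant
  \<open>D + 1 / \<gamma>\<close>.\<close>

lemma cadlag_sublinear_exp_bound:
  fixes f :: "real \<Rightarrow> 'b::real_normed_vector"
  assumes c: "cadlag f" and s: "sublinear_growth f" and "0 < \<gamma>"
  obtains C where "\<And>t. t \<le> 0 \<Longrightarrow> norm (f t) \<le> C * exp (- \<gamma> * t)"
proof -
  have "\<forall>\<^sub>F t in at_infinity. norm (f t) / \<bar>t\<bar> < 1"
    using s unfolding sublinear_growth_def by (rule order_tendstoD) simp
  then obtain b where b: "\<And>t. b \<le> norm t \<Longrightarrow> norm (f t) / \<bar>t\<bar> < 1"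
    by (auto simp: eventually_at_infinity)
  obtain D where D: "\<And>t. t \<in> {- \<bar>b\<bar> - 1..0} \<Longrightarrow> norm (f t) \<le> D"
    using cadlag_locally_bounded[OF c] by blast
  have "D \<ge> 0" using order.trans[OF norm_ge_zero D[of 0]] by simp
  have "norm (f t) \<le> (D + 1 / \<gamma>) * exp (- \<gamma> * t)" if t: "t \<le> 0" for t
  proof (cases "t < - \<bar>b\<bar> - 1")
    case True
    then have "b \<le> norm t" "t < 0" by auto
    then have "norm (f t) \<le> - t"
      using b[of t] by (simp add: neg_less_divide_eq abs_of_neg)
    also have "\<dots> \<le> 1 / \<gamma> * exp (- \<gamma> * t)"
      using exp_ge_add_one_self[of "- \<gamma> * t"] \<open>0 < \<gamma>\<close> by (simp add: field_simps)
    also have "\<dots> \<le> (D + 1 / \<gamma>) * exp (- \<gamma> * t)"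
      using \<open>D \<ge> 0\<close> by (intro mult_right_mono) auto
    finally show ?thesis .
  next
    case False
    then have "norm (f t) \<le> D" using D t by auto
    also have "D \<le> (D + 1 / \<gamma>) * 1" using \<open>0 < \<gamma>\<close> by simp
    also have "\<dots> \<le> (D + 1 / \<gamma>) * exp (- \<gamma> * t)"
      using \<open>0 < \<gamma>\<close> \<open>D \<ge> 0\<close> t by (intro mult_left_mono) (auto simp: mult_le_0_iff)
    finally show ?thesis .
  qed
  then show thesis by (rule that)
qed

lemma cadlag_scale_time:
  assumes "cadlag f" "0 < c"
  shows "cadlag (\<lambda>t. f (c * t))"
  unfolding cadlag_def
proof (intro allI conjI)
  fix t
  obtain l where r: "(f \<longlongrightarrow> f (c * t)) (at_right (c * t))" and l: "(f \<longlongrightarrow> l) (at_left (c * t))"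
    using assms by (auto simp: cadlag_def)
  have "filterlim (\<lambda>t. c * t) (at_right (c * t)) (at_right t)"
    unfolding filterlim_at using assms
    by (auto intro!: tendsto_intros simp: eventually_at_filter)
  with r show "((\<lambda>t. f (c * t)) \<longlongrightarrow> f (c * t)) (at_right t)" by (rule filterlim_compose)
  have "filterlim (\<lambda>t. c * t) (at_left (c * t)) (at_left t)"
    unfolding filterlim_at using assms
    by (auto intro!: tendsto_intros simp: eventually_at_filter)
  with l show "\<exists>l. ((\<lambda>t. f (c * t)) \<longlongrightarrow> l) (at_left t)" by (blast intro: filterlim_compose)
qed

lemma sublinear_growth_scale_time:
  assumes "sublinear_growth f" "0 < c"
  shows "sublinear_growth (\<lambda>t. f (c * t))"
proof -
  have "filterlim (\<lambda>t. c * t) at_infinity (at_infinity :: real filter)"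
    by (rule tendsto_mult_filterlim_at_infinity[OF tendsto_const _ filterlim_ident]) (use assms in auto)
  with assms have "((\<lambda>t. norm (f (c * t)) / \<bar>c * t\<bar>) \<longlongrightarrow> 0) at_infinity"
    unfolding sublinear_growth_def by (rule_tac filterlim_compose)
  then have "((\<lambda>t. c * (norm (f (c * t)) / \<bar>c * t\<bar>)) \<longlongrightarrow> c * 0) at_infinity"
    by (rule tendsto_mult_left)
  then show ?thesis using assms by (simp add: sublinear_growth_def abs_mult)
qed

subsection \<open>Riemann sums on uniform partitions\<close>

text \<open>A left-tagged Riemann-Stieltjes sum over [-T, 0] with \<open>Suc n\<close> equal pieces,
  so that the mesh is well defined for every n. It involves finitely many path values and is
  therefore visibly measurable, unlike an integral chosen by \<open>THE\<close>.\<close>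

definition uniform_sum ::
    "(real \<Rightarrow> real^'n^'n) \<Rightarrow> (real \<Rightarrow> real^'n) \<Rightarrow> real \<Rightarrow> nat \<Rightarrow> real^'n" where
  "uniform_sum \<Phi> \<omega> T n = (let h = T / Suc n in
     \<Sum>i<Suc n. \<Phi> (- T + real i * h) *v (\<omega> (- T + real (Suc i) * h) - \<omega> (- T + real i * h)))"

lemma uniform_tagged_division:
  fixes a h :: real
  assumes "h > 0"
  shows "(\<lambda>i. (a + real i * h, {a + real i * h..a + real (Suc i) * h})) ` {..<Suc n}
     tagged_division_of {a..a + real (Suc n) * h}"
proof (induction n)
  case 0
  show ?case using tagged_division_of_self_real[of a a "a + h"] assms by (simp add: lessThan_Suc)
next
  case (Suc n)
  let ?p = "\<lambda>i. (a + real i * h, {a + real i * h..a + real (Suc i) * h})"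
  have "{?p (Suc n)} \<union> ?p ` {..<Suc n} tagged_division_of
      {a + real (Suc n) * h..a + real (Suc (Suc n)) * h} \<union> {a..a + real (Suc n) * h}"
  proof (rule tagged_division_Un[OF _ Suc])
    show "{?p (Suc n)} tagged_division_of {a + real (Suc n) * h..a + real (Suc (Suc n)) * h}"
      using assms by (intro tagged_division_of_self_real) (simp add: mult_right_mono)
  qed auto
  moreover have "{a + real (Suc n) * h..a + real (Suc (Suc n)) * h} \<union> {a..a + real (Suc n) * h}
      = {a..a + real (Suc (Suc n)) * h}"
  proof -
    have *: "{y..z} \<union> {x..y} = {x..z}" if "x \<le> y" "y \<le> z" for x y z :: real
      using that by auto
    have "real (Suc n) * h \<le> real (Suc (Suc n)) * h" "0 \<le> real (Suc n) * h"
      using assms by (auto intro!: mult_right_mono)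
    then show ?thesis by (intro * add_left_mono) simp_all
  qed
  moreover have "{?p (Suc n)} \<union> ?p ` {..<Suc n} = ?p ` {..<Suc (Suc n)}"
    by (simp only: lessThan_Suc[of "Suc n"]) simp
  ultimately show ?case by simp
qed

lemma has_rs_integral_uniform_sum:
  assumes I: "has_rs_integral \<Phi> \<omega> I (- T) 0" and T: "T > 0"
  shows "uniform_sum \<Phi> \<omega> T \<longlonglongrightarrow> I"
proof (rule LIMSEQ_I)
  fix e :: real assume "e > 0"
  then obtain d where d: "d > 0" "\<And>p. p tagged_division_of {- T..0} \<Longrightarrow> (\<lambda>x. ball x d) fine p \<Longrightarrow>
      norm ((\<Sum>(x, K)\<in>p. \<Phi> x *v (\<omega> (Sup K) - \<omega> (Inf K))) - I) < e"
    using I[unfolded has_rs_integral_def, rule_format, OF \<open>e > 0\<close>] by (elim exE conjE) simp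
  \<comment> \<open>More than \<open>T / d\<close> equal pieces have mesh below d, which makes the
    partition fine for the constant gauge.\<close>
  obtain N where N: "T / d < real N" using reals_Archimedean2 by blast
  show "\<exists>N. \<forall>n\<ge>N. norm (uniform_sum \<Phi> \<omega> T n - I) < e"
  proof (intro exI allI impI)
    fix n assume "N \<le> n"
    define h where "h = T / Suc n"
    have h: "h > 0" "real (Suc n) * h = T" using T by (auto simp: h_def)
    have "T / d < real (Suc n)" using N \<open>N \<le> n\<close> by simp
    then have "h < d" using d T by (simp add: h_def field_simps)
    let ?p = "\<lambda>i. (- T + real i * h, {- T + real i * h..- T + real (Suc i) * h})"
    have le: "real i * h \<le> real (Suc i) * h" for i using h by (intro mult_right_mono) auto
    have inj: "inj_on ?p {..<Suc n}" using h by (auto simp: inj_on_def)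
    have "?p ` {..<Suc n} tagged_division_of {- T..0}"
      using uniform_tagged_division[OF h(1), of "- T" n] unfolding h(2) by simp
    moreover have "(\<lambda>x. ball x d) fine ?p ` {..<Suc n}"
      using \<open>h < d\<close> by (auto simp: fine_def dist_real_def algebra_simps)
    ultimately have "norm ((\<Sum>(x, K)\<in>?p ` {..<Suc n}. \<Phi> x *v (\<omega> (Sup K) - \<omega> (Inf K))) - I) < e"
      by (rule d(2))
    also have "(\<Sum>(x, K)\<in>?p ` {..<Suc n}. \<Phi> x *v (\<omega> (Sup K) - \<omega> (Inf K))) = uniform_sum \<Phi> \<omega> T n"
      unfolding sum.reindex[OF inj] uniform_sum_def Let_def h_def[symmetric] comp_def
      using le by (intro sum.cong refl) simp
    finally show "norm (uniform_sum \<Phi> \<omega> T n - I) < e" .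
  qed
qed

text \<open>Discrete horizons turn the improper limit into a sequence. The factor c allows horizons
  \<open>\<epsilon> * real (Suc N)\<close> for \<open>eta\<close>, matching horizons
  \<open>real (Suc N)\<close> for the rescaled path.\<close>

lemma rs_integral_minf_uniform_sum:
  assumes ex: "\<exists>I. has_rs_integral_minf \<Phi> \<omega> I" and c: "c > 0"
  shows "\<And>N. convergent (uniform_sum \<Phi> \<omega> (c * real (Suc N)))"
    and "(\<lambda>N. lim (uniform_sum \<Phi> \<omega> (c * real (Suc N)))) \<longlonglongrightarrow> rs_integral_minf \<Phi> \<omega>"
proof -
  have *: "(\<forall>N. convergent (uniform_sum \<Phi> \<omega> (c * real (Suc N)))) \<and>
      (\<lambda>N. lim (uniform_sum \<Phi> \<omega> (c * real (Suc N)))) \<longlonglongrightarrow> I" if I: "has_rs_integral_minf \<Phi> \<omega> I" for I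
  proof -
    obtain J where J: "\<And>T. T > 0 \<Longrightarrow> has_rs_integral \<Phi> \<omega> (J T) (-T) 0" "(J \<longlongrightarrow> I) at_top"
      using I by (auto simp: has_rs_integral_minf_def)
    have 1: "uniform_sum \<Phi> \<omega> (c * real (Suc N)) \<longlonglongrightarrow> J (c * real (Suc N))" for N
      using c by (intro has_rs_integral_uniform_sum J) auto
    have "filterlim (\<lambda>N. c * real (Suc N)) at_top sequentially"
      using c by (intro filterlim_tendsto_pos_mult_at_top[OF tendsto_const]
          filterlim_compose[OF filterlim_real_sequentially filterlim_Suc]) auto
    from filterlim_compose[OF J(2) this] show ?thesis
      unfolding limI[OF 1] using convergentI[OF 1] by blast
  qed
  \<comment> \<open>Every possible value I is the limit of one and the same sequence, so it is
    unique and \<open>THE\<close> picks it.\<close>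
  then have "has_rs_integral_minf \<Phi> \<omega> (rs_integral_minf \<Phi> \<omega>)"
    unfolding rs_integral_minf_def using ex by (metis LIMSEQ_unique theI')
  from *[OF this] show "\<And>N. convergent (uniform_sum \<Phi> \<omega> (c * real (Suc N)))"
    and "(\<lambda>N. lim (uniform_sum \<Phi> \<omega> (c * real (Suc N)))) \<longlonglongrightarrow> rs_integral_minf \<Phi> \<omega>" by auto
qed

subsection \<open>The stationary noise as a functional of the path\<close>

text \<open>The process \<open>xi F (path_shift t \<omega>)\<close> with the integral replaced by
  iterated limits of sums. It is defined for arbitrary functions, and \<open>path_eval\<close> keeps
  it jointly measurable in path and time.\<close>

definition noise :: "real^'n^'n \<Rightarrow> (real \<Rightarrow> real^'n) \<Rightarrow> real \<Rightarrow> real^'n" where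
  "noise F \<omega> t = lim (\<lambda>N. lim (uniform_sum (\<lambda>s. mexp ((- s) *\<^sub>R F)) (path_shift t (path_eval \<omega>)) (real (Suc N))))"

lemma measurable_noise:
  fixes F :: "real^'n^'n"
  assumes [measurable]: "\<And>t. (\<lambda>x. X x t) \<in> borel_measurable M"
  shows "(\<lambda>(x, t). noise F (X x) t) \<in> borel_measurable (M \<Otimes>\<^sub>M borel)"
proof -
  have [measurable]: "(\<lambda>p. path_eval (X (fst p)) (c + snd p)) \<in> borel_measurable (M \<Otimes>\<^sub>M borel)"
    "(\<lambda>p. path_eval (X (fst p)) (snd p)) \<in> borel_measurable (M \<Otimes>\<^sub>M borel)" for c
    by (intro measurable_path_eval; measurable)+
  have "(\<lambda>p. uniform_sum (\<lambda>s. mexp ((- s) *\<^sub>R F)) (path_shift (snd p) (path_eval (X (fst p)))) T n)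
      \<in> borel_measurable (M \<Otimes>\<^sub>M borel)" for T n
    unfolding uniform_sum_def Let_def path_shift_def
    by (intro borel_measurable_sum
        borel_measurable_continuous_on[OF matrix_vector_mult_linear_continuous_on] borel_measurable_diff) measurable
  then show ?thesis
    unfolding noise_def case_prod_beta
    by (intro borel_measurable_lim_metric) simp
qed

lemma noise_eq_xi:
  assumes "cadlag \<omega>" "\<exists>I. has_rs_integral_minf (\<lambda>s. mexp ((- s) *\<^sub>R F)) (path_shift t \<omega>) I"
  shows "noise F \<omega> t = xi F (path_shift t \<omega>)"
  unfolding noise_def xi_def path_eval_cadlag[OF assms(1)]
  using rs_integral_minf_uniform_sum(2)[OF assms(2), of 1] by (intro limI) simp

text \<open>The map \<open>R\<close>; its exponent is the one in the self-similarity of the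
  \<alpha>-stable process.\<close>

definition rescale :: "real \<Rightarrow> real \<Rightarrow> (real \<Rightarrow> 'b::real_vector) \<Rightarrow> real \<Rightarrow> 'b" where
  "rescale \<alpha> \<epsilon> \<omega> = (\<lambda>t. \<epsilon> powr (- 1 / \<alpha>) *\<^sub>R \<omega> (\<epsilon> * t))"

lemma cadlag_rescale:
  fixes \<omega> :: "real \<Rightarrow> 'b::real_normed_vector"
  assumes "cadlag \<omega>" "0 < \<epsilon>"
  shows "cadlag (rescale \<alpha> \<epsilon> \<omega>)"
  unfolding cadlag_def rescale_def
proof (intro allI conjI)
  fix t
  obtain l where r: "((\<lambda>t. \<omega> (\<epsilon> * t)) \<longlongrightarrow> \<omega> (\<epsilon> * t)) (at_right t)"
    and l: "((\<lambda>t. \<omega> (\<epsilon> * t)) \<longlongrightarrow> l) (at_left t)"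
    using cadlag_scale_time[OF assms] by (auto simp: cadlag_def)
  show "((\<lambda>t. \<epsilon> powr (- 1 / \<alpha>) *\<^sub>R \<omega> (\<epsilon> * t)) \<longlongrightarrow> \<epsilon> powr (- 1 / \<alpha>) *\<^sub>R \<omega> (\<epsilon> * t)) (at_right t)"
    by (rule tendsto_scaleR[OF tendsto_const r])
  show "\<exists>l. ((\<lambda>t. \<epsilon> powr (- 1 / \<alpha>) *\<^sub>R \<omega> (\<epsilon> * t)) \<longlongrightarrow> l) (at_left t)"
    by (rule exI, rule tendsto_scaleR[OF tendsto_const l])
qed

text \<open>Scaling by \<epsilon> carries the uniform partition of [-T, 0] to that of
  [-\<epsilon>T, 0]. The substitution in the stochastic integral is thus an exact identity between
  sums, before any limit is taken.\<close>

lemma uniform_sum_rescale: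
  assumes "0 < \<epsilon>"
  shows "uniform_sum (\<lambda>s. mexp ((- s) *\<^sub>R F)) (path_shift t (rescale \<alpha> \<epsilon> \<omega>)) T n =
    \<epsilon> powr (- 1 / \<alpha>) *\<^sub>R uniform_sum (\<lambda>s. mexp ((- s / \<epsilon>) *\<^sub>R F)) (path_shift (\<epsilon> * t) \<omega>) (\<epsilon> * T) n"
proof -
  have *: "- (\<epsilon> * T) + real i * (\<epsilon> * T / real (Suc n)) = \<epsilon> * (- T + real i * (T / real (Suc n)))" for i
    by (simp add: algebra_simps del: of_nat_Suc)
  have **: "- (\<epsilon> * x) / \<epsilon> = - x" for x using assms by simp
  show ?thesis
    unfolding uniform_sum_def Let_def scaleR_sum_right * **
    by (intro sum.cong refl)
      (simp add: path_shift_def rescale_def matrix_vector_mult_scaleR[symmetric] scaleR_diff_right distrib_left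
        del: of_nat_Suc)
qed

lemma noise_rescale_eq_eta:
  assumes "cadlag \<omega>" "0 < \<epsilon>"
    and ex: "\<exists>I. has_rs_integral_minf (\<lambda>s. mexp ((- s / \<epsilon>) *\<^sub>R F)) (path_shift (\<epsilon> * t) \<omega>) I"
  shows "noise F (rescale \<alpha> \<epsilon> \<omega>) t = eta \<alpha> F \<epsilon> (path_shift (\<epsilon> * t) \<omega>)"
proof -
  note c = rs_integral_minf_uniform_sum[OF ex assms(2)]
  have "lim (uniform_sum (\<lambda>s. mexp ((- s) *\<^sub>R F)) (path_shift t (rescale \<alpha> \<epsilon> \<omega>)) (real (Suc N))) =
      \<epsilon> powr (- 1 / \<alpha>) *\<^sub>R lim (uniform_sum (\<lambda>s. mexp ((- s / \<epsilon>) *\<^sub>R F)) (path_shift (\<epsilon> * t) \<omega>) (\<epsilon> * real (Suc N)))" for N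
    unfolding uniform_sum_rescale[OF assms(2), abs_def]
    using c(1)[of N] by (intro limI tendsto_scaleR tendsto_const) (simp add: convergent_LIMSEQ_iff)
  then show ?thesis
    unfolding noise_def eta_def path_eval_cadlag[OF cadlag_rescale[OF assms(1,2)]]
    using c(2) by (auto intro!: limI tendsto_scaleR)
qed

subsection \<open>Self-similarity of the path law\<close>

text \<open>Cylinder sets determine a probability measure on the product space, and the values at
  finitely many times are sums of increments over a sorted grid. The joint law of these increments
  is the product of their laws, which agree for the two processes.\<close>

lemma distr_eq_of_increments:
  fixes X Y :: "real \<Rightarrow> 'a \<Rightarrow> 'b::euclidean_space"
  assumes M: "prob_space M"
    and X[measurable]: "\<And>t. X t \<in> borel_measurable M" and Y[measurable]: "\<And>t. Y t \<in> borel_measurable M"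
    and zero: "\<And>\<omega>. \<omega> \<in> space M \<Longrightarrow> X 0 \<omega> = 0" "\<And>\<omega>. \<omega> \<in> space M \<Longrightarrow> Y 0 \<omega> = 0"
    and indep_X: "\<And>(\<tau> :: nat \<Rightarrow> real) n. mono \<tau> \<Longrightarrow>
        prob_space.indep_vars M (\<lambda>_. borel) (\<lambda>i \<omega>. X (\<tau> (Suc i)) \<omega> - X (\<tau> i) \<omega>) {..<n}"
    and indep_Y: "\<And>(\<tau> :: nat \<Rightarrow> real) n. mono \<tau> \<Longrightarrow>
        prob_space.indep_vars M (\<lambda>_. borel) (\<lambda>i \<omega>. Y (\<tau> (Suc i)) \<omega> - Y (\<tau> i) \<omega>) {..<n}"
    and law: "\<And>s t. s \<le> t \<Longrightarrow>
        distr M borel (\<lambda>\<omega>. X t \<omega> - X s \<omega>) = distr M borel (\<lambda>\<omega>. Y t \<omega> - Y s \<omega>)"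
  shows "distr M (\<Pi>\<^sub>M t\<in>UNIV. borel) (\<lambda>\<omega> t. X t \<omega>) = distr M (\<Pi>\<^sub>M t\<in>UNIV. borel) (\<lambda>\<omega> t. Y t \<omega>)"
proof -
  interpret prob_space M by (rule M)
  have mX[measurable]: "(\<lambda>\<omega> t. X t \<omega>) \<in> measurable M (\<Pi>\<^sub>M t\<in>UNIV. borel)"
    and mY[measurable]: "(\<lambda>\<omega> t. Y t \<omega>) \<in> measurable M (\<Pi>\<^sub>M t\<in>UNIV. borel)"
    by (auto intro!: measurable_PiM_single' simp: PiE_UNIV_domain)
  show ?thesis
  proof (rule measure_eqI_PiM_infinite)
    fix J :: "real set" and E :: "real \<Rightarrow> 'b set"
    assume J: "finite J" and E: "\<And>i. i \<in> J \<Longrightarrow> E i \<in> sets borel"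
    \<comment> \<open>Time 0 joins the grid because the processes are pinned there; this turns
      increments into values, also at negative times.\<close>
    define L where "L = sorted_list_of_set (insert 0 J)"
    define n where "n = length L"
    \<comment> \<open>The grid is continued by its last point to a monotone sequence on all
      naturals; the increment with index \<open>n - 1\<close> is then zero.\<close>
    define \<tau> where "\<tau> i = L ! min i (n - 1)" for i
    have L: "set L = insert 0 J" "sorted L" 
      by (simp_all only: L_def set_sorted_list_of_set finite_insert J sorted_sorted_list_of_set)
    then have "n > 0" unfolding n_def by (cases L) auto
    have "mono \<tau>"
      unfolding \<tau>_def by (intro monoI sorted_nth_mono[OF L(2)]) (use \<open>n > 0\<close> in \<open>unfold n_def, linarith+\<close>)
    have "\<exists>i<n. \<tau> i = j" if j: "j \<in> insert 0 J" for j
    proof -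
      have "j \<in> set L" using j L(1) by blast
      then obtain i where "i < n" "L ! i = j" unfolding n_def in_set_conv_nth by blast
      then show ?thesis by (intro exI[of _ i]) (simp add: \<tau>_def min_absorb1)
    qed
    then obtain k where k: "\<And>j. j \<in> insert 0 J \<Longrightarrow> k j < n" "\<And>j. j \<in> insert 0 J \<Longrightarrow> \<tau> (k j) = j"
      by metis
    \<comment> \<open>The value at j recovered from the increments d: both partial sums start at the
      leftmost grid point, so their difference is the increment from 0 to j, whatever the sign of
      j.\<close>
    define r where "r j d = (\<Sum>i<k j. d i) - (\<Sum>i<k 0. d i)" for j and d :: "nat \<Rightarrow> 'b"
    let ?D = "\<lambda>Z \<omega>. \<lambda>i\<in>{..<n}. Z (\<tau> (Suc i)) \<omega> - Z (\<tau> i) \<omega> :: 'b"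
    define C where "C = {d \<in> space (\<Pi>\<^sub>M i\<in>{..<n}. borel). \<forall>j\<in>J. r j d \<in> E j}"
    have [measurable]: "C \<in> sets (\<Pi>\<^sub>M i\<in>{..<n}. borel)"
      unfolding C_def
    proof (intro sets.sets_Collect_finite_All J)
      fix j assume "j \<in> J"
      have m: "(\<lambda>d. \<Sum>i<k j'. d i) \<in> borel_measurable (\<Pi>\<^sub>M i\<in>{..<n}. (borel :: 'b measure))" if "k j' < n" for j'
        using that by (intro borel_measurable_sum measurable_component_singleton) auto
      then have [measurable]: "r j \<in> borel_measurable (\<Pi>\<^sub>M i\<in>{..<n}. borel)"
        unfolding r_def[abs_def] using m[OF k(1)[of j]] m[OF k(1)[of 0]] \<open>j \<in> J\<close>
        by (intro borel_measurable_diff) auto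
      note E[OF \<open>j \<in> J\<close>, measurable]
      show "{d \<in> space (\<Pi>\<^sub>M i\<in>{..<n}. borel). r j d \<in> E j} \<in> sets (\<Pi>\<^sub>M i\<in>{..<n}. borel)"
        by measurable
    qed
    have *: "emeasure (distr M (\<Pi>\<^sub>M t\<in>UNIV. borel) (\<lambda>\<omega> t. Z t \<omega>))
        (prod_emb UNIV (\<lambda>_. borel) J (Pi\<^sub>E J E)) = emeasure (distr M (\<Pi>\<^sub>M i\<in>{..<n}. borel) (?D Z)) C"
      if Z: "\<And>t. Z t \<in> borel_measurable M" "\<And>\<omega>. \<omega> \<in> space M \<Longrightarrow> Z 0 \<omega> = 0"
        and mZ: "(\<lambda>\<omega> t. Z t \<omega>) \<in> measurable M (\<Pi>\<^sub>M t\<in>UNIV. borel)" for Z :: "real \<Rightarrow> 'a \<Rightarrow> 'b"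
    proof -
      have mD: "?D Z \<in> measurable M (\<Pi>\<^sub>M i\<in>{..<n}. borel)"
        using Z(1) by (intro measurable_restrict borel_measurable_diff) auto
      have r: "r j (?D Z \<omega>) = Z j \<omega>" if "\<omega> \<in> space M" "j \<in> J" for j \<omega>
      proof -
        have "(\<Sum>i<k j'. ?D Z \<omega> i) = Z j' \<omega> - Z (\<tau> 0) \<omega>" if "j' \<in> insert 0 J" for j'
        proof -
          have "(\<Sum>i<k j'. ?D Z \<omega> i) = (\<Sum>i<k j'. Z (\<tau> (Suc i)) \<omega> - Z (\<tau> i) \<omega>)"
            using k(1)[OF that] by (intro sum.cong) auto
          also have "\<dots> = Z (\<tau> (k j')) \<omega> - Z (\<tau> 0) \<omega>"
            by (rule sum_lessThan_telescope)
          finally show ?thesis using k(2)[OF that] by simp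
        qed
        from this[of j] this[of 0] that Z(2)[OF that(1)] show ?thesis unfolding r_def by simp
      qed
      have "(\<lambda>\<omega> t. Z t \<omega>) -` prod_emb UNIV (\<lambda>_. borel) J (Pi\<^sub>E J E) \<inter> space M = ?D Z -` C \<inter> space M"
      proof -
        have "((\<lambda>t. Z t \<omega>) \<in> prod_emb UNIV (\<lambda>_. borel) J (Pi\<^sub>E J E)) \<longleftrightarrow> ?D Z \<omega> \<in> C" if "\<omega> \<in> space M" for \<omega>
          using measurable_space[OF mD that] r[OF that]
          by (auto simp: prod_emb_def C_def space_PiM)
        then show ?thesis by auto
      qed
      moreover have "prod_emb UNIV (\<lambda>_. borel) J (Pi\<^sub>E J E) \<in> sets (\<Pi>\<^sub>M t\<in>UNIV. (borel :: 'b measure))"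
        using J E by (intro sets_PiM_I) auto
      ultimately show ?thesis
        by (simp add: emeasure_distr[OF mZ] emeasure_distr[OF mD])
    qed
    have "distr M (\<Pi>\<^sub>M i\<in>{..<n}. borel) (?D X) = (\<Pi>\<^sub>M i\<in>{..<n}. distr M borel (\<lambda>\<omega>. X (\<tau> (Suc i)) \<omega> - X (\<tau> i) \<omega>))"
      using indep_X[OF \<open>mono \<tau>\<close>, of n] \<open>n > 0\<close> by (subst (asm) indep_vars_iff_distr_eq_PiM) auto
    also have "\<dots> = (\<Pi>\<^sub>M i\<in>{..<n}. distr M borel (\<lambda>\<omega>. Y (\<tau> (Suc i)) \<omega> - Y (\<tau> i) \<omega>))"
      using \<open>mono \<tau>\<close> by (intro PiM_cong refl law) (auto simp: mono_def)
    also have "\<dots> = distr M (\<Pi>\<^sub>M i\<in>{..<n}. borel) (?D Y)"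
      using indep_Y[OF \<open>mono \<tau>\<close>, of n] \<open>n > 0\<close> by (subst (asm) indep_vars_iff_distr_eq_PiM) auto
    finally show "emeasure (distr M (\<Pi>\<^sub>M t\<in>UNIV. borel) (\<lambda>\<omega> t. X t \<omega>))
        (prod_emb UNIV (\<lambda>_. borel) J (Pi\<^sub>E J E)) = emeasure (distr M (\<Pi>\<^sub>M t\<in>UNIV. borel) (\<lambda>\<omega> t. Y t \<omega>))
        (prod_emb UNIV (\<lambda>_. borel) J (Pi\<^sub>E J E))"
      using *[of X] *[of Y] X Y zero mX mY by simp
  next
    show "finite_measure (distr M (\<Pi>\<^sub>M t\<in>UNIV. borel) (\<lambda>\<omega> t. X t \<omega>))"
      by (intro finite_measure_distr mX)
  qed simp_all
qed

lemma distr_scaleR: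
  fixes f g :: "'a \<Rightarrow> 'b::euclidean_space"
  assumes [measurable]: "f \<in> borel_measurable M" "g \<in> borel_measurable M"
    and eq: "distr M borel f = distr M borel g"
  shows "distr M borel (\<lambda>\<omega>. c *\<^sub>R f \<omega>) = distr M borel (\<lambda>\<omega>. c *\<^sub>R g \<omega>)"
proof -
  have *: "distr M borel (\<lambda>\<omega>. c *\<^sub>R h \<omega>) = distr (distr M borel h) borel (\<lambda>x. c *\<^sub>R x)"
    if "h \<in> borel_measurable M" for h :: "'a \<Rightarrow> 'b"
    using that by (subst distr_distr) (auto simp: comp_def)
  show ?thesis using assms by (simp add: *)
qed

text \<open>Stability speaks about single times; stationarity and independence of the increments
  lift it to paths. An increment of the rescaled process over [s, t] is distributed as
  \<open>X 1\<close> times \<open>\<epsilon> powr (- 1 / \<alpha>) * (\<epsilon> * (t - s)) powr (1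
  / \<alpha>)\<close>, where \<epsilon> cancels.\<close>

lemma distr_rescale:
  fixes X :: "real \<Rightarrow> 'a \<Rightarrow> 'b::euclidean_space"
  assumes stable: "stable_levy_process \<alpha> M X" and \<epsilon>: "0 < \<epsilon>"
  shows "distr M (\<Pi>\<^sub>M t\<in>UNIV. borel) (\<lambda>\<omega> t. X t \<omega>) =
    distr M (\<Pi>\<^sub>M t\<in>UNIV. borel) (\<lambda>\<omega>. rescale \<alpha> \<epsilon> (\<lambda>t. X t \<omega>))"
  unfolding rescale_def
proof (rule distr_eq_of_increments)
  let ?c = "\<epsilon> powr (- 1 / \<alpha>)"
  show "prob_space M" using stable by (simp add: stable_levy_process_def two_sided_levy_process_def)
  then interpret prob_space M .
  show X[measurable]: "X t \<in> borel_measurable M" for t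
    using stable by (simp add: stable_levy_process_def two_sided_levy_process_def)
  then show "(\<lambda>\<omega>. ?c *\<^sub>R X (\<epsilon> * t) \<omega>) \<in> borel_measurable M" for t
    by simp
  show zero: "X 0 \<omega> = 0" if "\<omega> \<in> space M" for \<omega>
    using stable that by (simp add: stable_levy_process_def two_sided_levy_process_def)
  then show "?c *\<^sub>R X (\<epsilon> * 0) \<omega> = 0" if "\<omega> \<in> space M" for \<omega>
    using that by simp
  show indep: "indep_vars (\<lambda>_. borel) (\<lambda>i \<omega>. X (\<tau> (Suc i)) \<omega> - X (\<tau> i) \<omega>) {..<n}"
    if "mono \<tau>" for \<tau> :: "nat \<Rightarrow> real" and n
    using stable that by (simp add: stable_levy_process_def two_sided_levy_process_def)
  show "indep_vars (\<lambda>_. borel) (\<lambda>i \<omega>. ?c *\<^sub>R X (\<epsilon> * \<tau> (Suc i)) \<omega> - ?c *\<^sub>R X (\<epsilon> * \<tau> i) \<omega>) {..<n}"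
    if "mono \<tau>" for \<tau> :: "nat \<Rightarrow> real" and n
  proof -
    have "mono (\<lambda>i. \<epsilon> * \<tau> i)" using that \<epsilon> by (auto simp: mono_def)
    from indep_vars_compose2[OF indep[OF this], where Y="\<lambda>_ x. ?c *\<^sub>R x" and N="\<lambda>_. borel"]
    show ?thesis by (simp add: scaleR_diff_right)
  qed
  show "distr M borel (\<lambda>\<omega>. X t \<omega> - X s \<omega>) =
      distr M borel (\<lambda>\<omega>. ?c *\<^sub>R X (\<epsilon> * t) \<omega> - ?c *\<^sub>R X (\<epsilon> * s) \<omega>)" if "s \<le> t" for s t
  proof -
    have stat: "distr M borel (\<lambda>\<omega>. X t \<omega> - X s \<omega>) = distr M borel (X (t - s))" if "s \<le> t" for s t
      using stable that by (simp add: stable_levy_process_def two_sided_levy_process_def)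
    have law: "distr M borel (X t) = distr M borel (\<lambda>\<omega>. (t powr (1 / \<alpha>)) *\<^sub>R X 1 \<omega>)" if "t > 0" for t
      using stable that by (simp add: stable_levy_process_def)
    have "distr M borel (\<lambda>\<omega>. ?c *\<^sub>R X (\<epsilon> * t) \<omega> - ?c *\<^sub>R X (\<epsilon> * s) \<omega>) =
        distr M borel (\<lambda>\<omega>. ?c *\<^sub>R X (\<epsilon> * (t - s)) \<omega>)"
      using distr_scaleR[OF _ _ stat[of "\<epsilon> * s" "\<epsilon> * t"], of ?c] \<epsilon> \<open>s \<le> t\<close>
      by (simp add: scaleR_diff_right right_diff_distrib)
    also have "\<dots> = distr M borel (X (t - s))"
    \<comment> \<open>Stability is postulated for positive times only, so the empty increment is
      handled by \<open>X 0 = 0\<close>.\<close>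
    proof (cases "s = t")
      case True
      then show ?thesis using zero by (auto intro!: distr_cong)
    next
      case False
      then have pos: "0 < t - s" using \<open>s \<le> t\<close> by simp
      have "distr M borel (\<lambda>\<omega>. ?c *\<^sub>R X (\<epsilon> * (t - s)) \<omega>) =
          distr M borel (\<lambda>\<omega>. ?c *\<^sub>R ((\<epsilon> * (t - s)) powr (1 / \<alpha>)) *\<^sub>R X 1 \<omega>)"
        using pos \<epsilon> by (intro distr_scaleR law) auto
      also have "\<dots> = distr M borel (\<lambda>\<omega>. ((t - s) powr (1 / \<alpha>)) *\<^sub>R X 1 \<omega>)"
        using pos \<epsilon> by (simp add: powr_mult powr_minus divide_simps mult.assoc[symmetric])
      also have "\<dots> = distr M borel (X (t - s))" by (rule law[OF pos, symmetric])
      finally show ?thesis .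
    qed
    finally show ?thesis using stat[OF \<open>s \<le> t\<close>] by simp
  qed
qed

lemma (in prob_space) distr_restrict_space_full:
  assumes \<Omega>: "\<Omega> \<in> sets M" "emeasure M \<Omega> = 1" and f[measurable]: "f \<in> measurable M N"
  shows "distr (restrict_space M \<Omega>) N f = distr M N f"
proof (rule measure_eqI)
  fix B assume "B \<in> sets (distr (restrict_space M \<Omega>) N f)"
  then have B[measurable]: "B \<in> sets N" by simp
  have \<Omega>_sub: "\<Omega> \<subseteq> space M" using \<Omega> by (simp add: sets.sets_into_space)
  have ae: "AE x in M. x \<in> \<Omega>"
    using \<Omega> by (intro AE_prob_1) (simp add: measure_def)
  have "emeasure (distr (restrict_space M \<Omega>) N f) B = emeasure M (f -` B \<inter> \<Omega>)"
    using \<Omega> \<Omega>_sub by (subst emeasure_distr)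
      (auto simp: emeasure_restrict_space space_restrict_space Int_absorb2 intro: measurable_restrict_space1)
  also have "\<dots> = emeasure M (f -` B \<inter> space M)"
  proof (rule emeasure_eq_AE)
    show "AE x in M. (x \<in> f -` B \<inter> \<Omega>) = (x \<in> f -` B \<inter> space M)"
      using ae by eventually_elim (use \<Omega>_sub in auto)
    have "f -` B \<inter> \<Omega> = (f -` B \<inter> space M) \<inter> \<Omega>" using \<Omega>_sub by auto
    then show "f -` B \<inter> \<Omega> \<in> sets M" using \<Omega> measurable_sets[OF f B] by auto
    show "f -` B \<inter> space M \<in> sets M" by measurable
  qed
  finally show "emeasure (distr (restrict_space M \<Omega>) N f) B = emeasure (distr M N f) B"
    by (simp add: emeasure_distr)
qed simp

subsection \<open>Time change between the two systems\<close>

lemma interval_integral_zero_nonpos: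
  fixes f :: "real \<Rightarrow> 'a::{banach, second_countable_topology}"
  assumes "t \<le> 0"
  shows "(LBINT s=0..ereal t. f s) = - (LINT s:{t<..<0}|lborel. f s)"
  using assms by (auto simp: interval_lebesgue_integral_def zero_ereal_def set_lebesgue_integral_def)

lemma interval_integral_minf:
  fixes f :: "real \<Rightarrow> 'a::{banach, second_countable_topology}"
  shows "(LBINT s=-\<infinity>..ereal t. f s) = (LINT s:{..<t}|lborel. f s)"
proof -
  have "einterval (-\<infinity>) (ereal t) = {..<t}" by (auto simp: einterval_def)
  then show ?thesis by (simp add: interval_lebesgue_integral_def)
qed

text \<open>Affine substitution in the Bochner integral requires no integrability, so the time
  change works for arbitrary candidate solutions.\<close>

lemma interval_integral_scale_time:
  fixes f :: "real \<Rightarrow> 'a::{banach, second_countable_topology}"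
  assumes "0 < c" "t \<le> 0"
  shows "(LBINT s=0..ereal (c * t). f s) = c *\<^sub>R (LBINT s=0..ereal t. f (c * s))"
    and "(LBINT s=-\<infinity>..ereal (c * t). f s) = c *\<^sub>R (LBINT s=-\<infinity>..ereal t. f (c * s))"
proof -
  have ind: "indicat_real {c * t<..<0} (c * s) = indicat_real {t<..<0} s"
    "indicat_real {..<c * t} (c * s) = indicat_real {..<t} s" for s
    using assms by (auto simp: indicator_def mult_less_0_iff)
  have "c * t \<le> 0" using assms by (simp add: mult_le_0_iff)
  then show "(LBINT s=0..ereal (c * t). f s) = c *\<^sub>R (LBINT s=0..ereal t. f (c * s))"
    using assms lborel_integral_real_affine[of c "\<lambda>s. indicator {c * t<..<0} s *\<^sub>R f s" 0]
    by (simp add: interval_integral_zero_nonpos set_lebesgue_integral_def ind)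
  show "(LBINT s=-\<infinity>..ereal (c * t). f s) = c *\<^sub>R (LBINT s=-\<infinity>..ereal t. f (c * s))"
    using assms lborel_integral_real_affine[of c "\<lambda>s. indicator {..<c * t} s *\<^sub>R f s" 0]
    by (simp add: interval_integral_minf set_lebesgue_integral_def ind)
qed

text \<open>A positive factor preserves the half-line, hence also extensionality, and multiplies the
  exponent of the weight. With c = \<epsilon> the exponent \<open>- \<gamma> / \<epsilon>\<close>
  becomes \<open>- \<gamma>\<close>.\<close>

lemma C_minus_scale_time:
  assumes "(x, y) \<in> C_minus \<beta>" "0 < c"
  shows "(\<lambda>t. x (c * t), \<lambda>t. y (c * t)) \<in> C_minus (c * \<beta>)"
proof -
  have le: "c * t \<le> 0 \<longleftrightarrow> t \<le> 0" for t using assms(2) by (simp add: mult_le_0_iff)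
  have ext: "(\<lambda>t. f (c * t)) \<in> extensional {..0}" if "f \<in> extensional {..0}" for f :: "real \<Rightarrow> 'z"
    using that unfolding extensional_def by (simp add: le)
  have cont: "continuous_on {..0} (\<lambda>t. f (c * t))" if "continuous_on {..0} f" for f :: "real \<Rightarrow> 'z::topological_space"
    by (intro continuous_on_compose2[OF that] continuous_intros) (simp add: image_subset_iff le)
  have bdd: "bdd_above ((\<lambda>t. norm (exp (- (c * \<beta>) * t) *\<^sub>R f (c * t))) ` {..0})"
    if "bdd_above ((\<lambda>t. norm (exp (- \<beta> * t) *\<^sub>R f t)) ` {..0})" for f :: "real \<Rightarrow> 'z::real_normed_vector"
  proof (rule bdd_above_mono[OF that])
    show "(\<lambda>t. norm (exp (- (c * \<beta>) * t) *\<^sub>R f (c * t))) ` {..0} \<subseteq> (\<lambda>t. norm (exp (- \<beta> * t) *\<^sub>R f t)) ` {..0}"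
    proof (rule image_subsetI)
      fix t :: real assume "t \<in> {..0}"
      then have "c * t \<in> {..0}" by (simp add: le)
      then show "norm (exp (- (c * \<beta>) * t) *\<^sub>R f (c * t)) \<in> (\<lambda>t. norm (exp (- \<beta> * t) *\<^sub>R f t)) ` {..0}"
        by (rule image_eqI[rotated]) (simp add: mult_ac)
    qed
  qed
  show ?thesis
    using assms(1) unfolding C_minus_def mem_Collect_eq prod.case
    by (elim conjE) (intro conjI ext cont bdd)
qed

lemma C_minus_scale_time_iff:
  assumes "0 < c"
  shows "(\<lambda>t. x (c * t), \<lambda>t. y (c * t)) \<in> C_minus (c * \<beta>) \<longleftrightarrow> (x, y) \<in> C_minus \<beta>"
  using C_minus_scale_time[of "\<lambda>t. x (c * t)" "\<lambda>t. y (c * t)" "c * \<beta>" "1 / c"] C_minus_scale_time[of x y \<beta> c] assms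
  by auto

text \<open>Substituting s = \<epsilon>u gives each integral a factor \<epsilon>: it appears in the
  slow equation and cancels \<open>1 / \<epsilon>\<close> in the fast one. Being an equivalence for
  every pair, it transports both existence and uniqueness.\<close>

lemma hat_solution_iff_tilde_solution:
  assumes \<epsilon>: "0 < \<epsilon>"
  shows "hat_solution S F g1 g2 \<sigma> \<gamma> \<epsilon> z x0 (x, y) \<longleftrightarrow>
    tilde_solution S F g1 g2 \<sigma> \<gamma> \<epsilon> (\<lambda>t. z (\<epsilon> * t)) x0 (\<lambda>t. x (\<epsilon> * t), \<lambda>t. y (\<epsilon> * t))"
proof -
  have ball: "(\<forall>t\<le>0. Q (\<epsilon> * t)) \<longleftrightarrow> (\<forall>t\<le>0. Q t)" for Q :: "real \<Rightarrow> bool"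
  proof safe
    fix t :: real assume "\<forall>t\<le>0. Q (\<epsilon> * t)" "t \<le> 0"
    then show "Q t" using \<epsilon> by (auto dest!: spec[of _ "t / \<epsilon>"] simp: divide_le_0_iff)
  qed (use \<epsilon> in \<open>auto simp: mult_le_0_iff\<close>)
  have C: "(x, y) \<in> C_minus (- \<gamma> / \<epsilon>) \<longleftrightarrow> (\<lambda>t. x (\<epsilon> * t), \<lambda>t. y (\<epsilon> * t)) \<in> C_minus (- \<gamma>)"
    using C_minus_scale_time_iff[OF \<epsilon>, of x y "- \<gamma> / \<epsilon>"] \<epsilon> by simp
  have X: "(LBINT s=0..ereal (\<epsilon> * t). mexp ((\<epsilon> * t - s) *\<^sub>R S) *v g1 (x s) (y s + \<sigma> *\<^sub>R z s)) =
      \<epsilon> *\<^sub>R (LBINT s=0..ereal t. mexp ((\<epsilon> * (t - s)) *\<^sub>R S) *v g1 (x (\<epsilon> * s)) (y (\<epsilon> * s) + \<sigma> *\<^sub>R z (\<epsilon> * s)))"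
    if "t \<le> 0" for t
    using interval_integral_scale_time(1)[OF \<epsilon> that] by (simp add: right_diff_distrib)
  have Y: "(LBINT s=-\<infinity>..ereal (\<epsilon> * t). mexp (((\<epsilon> * t - s) / \<epsilon>) *\<^sub>R F) *v g2 (x s) (y s + \<sigma> *\<^sub>R z s)) =
      \<epsilon> *\<^sub>R (LBINT s=-\<infinity>..ereal t. mexp ((t - s) *\<^sub>R F) *v g2 (x (\<epsilon> * s)) (y (\<epsilon> * s) + \<sigma> *\<^sub>R z (\<epsilon> * s)))"
    if "t \<le> 0" for t
  proof -
    have "(\<epsilon> * t - \<epsilon> * s) / \<epsilon> = t - s" for s
      using \<epsilon> by (simp add: right_diff_distrib[symmetric])
    then show ?thesis
      by (subst interval_integral_scale_time(2)[OF \<epsilon> that]) simp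
  qed
  show ?thesis
    unfolding hat_solution_def tilde_solution_def prod.case C
    by (subst ball[symmetric]) (use \<epsilon> in \<open>auto simp: X Y\<close>)
qed

lemma ex1_hat_solution:
  assumes \<epsilon>: "0 < \<epsilon>"
    and ex1: "\<exists>!xy. tilde_solution S F g1 g2 \<sigma> \<gamma> \<epsilon> (\<lambda>t. z (\<epsilon> * t)) x0 xy"
  shows "\<exists>!xy. hat_solution S F g1 g2 \<sigma> \<gamma> \<epsilon> z x0 xy"
proof (rule ex_ex1I)
  obtain x y where xy: "tilde_solution S F g1 g2 \<sigma> \<gamma> \<epsilon> (\<lambda>t. z (\<epsilon> * t)) x0 (x, y)"
    using ex1 by auto
  have "hat_solution S F g1 g2 \<sigma> \<gamma> \<epsilon> z x0 (\<lambda>t. x (t / \<epsilon>), \<lambda>t. y (t / \<epsilon>))"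
    unfolding hat_solution_iff_tilde_solution[OF \<epsilon>] using xy \<epsilon> by simp
  then show "\<exists>xy. hat_solution S F g1 g2 \<sigma> \<gamma> \<epsilon> z x0 xy" by blast
next
  fix p q assume "hat_solution S F g1 g2 \<sigma> \<gamma> \<epsilon> z x0 p" "hat_solution S F g1 g2 \<sigma> \<gamma> \<epsilon> z x0 q"
  moreover obtain x y x' y' where [simp]: "p = (x, y)" "q = (x', y')" by (cases p, cases q) auto
  ultimately have "(\<lambda>t. x (\<epsilon> * t), \<lambda>t. y (\<epsilon> * t)) = (\<lambda>t. x' (\<epsilon> * t), \<lambda>t. y' (\<epsilon> * t))"
    using ex1 by (auto simp: hat_solution_iff_tilde_solution[OF \<epsilon>])
  then have "x (\<epsilon> * (t / \<epsilon>)) = x' (\<epsilon> * (t / \<epsilon>)) \<and> y (\<epsilon> * (t / \<epsilon>)) = y' (\<epsilon> * (t / \<epsilon>))" for t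
    unfolding prod.inject fun_eq_iff by blast
  moreover have "\<epsilon> * (t / \<epsilon>) = t" for t using \<epsilon> by simp
  ultimately show "p = q" by (simp add: fun_eq_iff)
qed

text \<open>The integral that defines the height is the right-hand side of the fast equation at t =
  0.\<close>

lemma hat_h_eq:
  assumes "\<exists>!xy. hat_solution S F g1 g2 \<sigma> \<gamma> \<epsilon> (\<lambda>t. eta \<alpha> F \<epsilon> (path_shift t \<omega>)) x0 xy"
    and "hat_solution S F g1 g2 \<sigma> \<gamma> \<epsilon> (\<lambda>t. eta \<alpha> F \<epsilon> (path_shift t \<omega>)) x0 (x, y)"
  shows "hat_h \<alpha> S F g1 g2 \<sigma> \<gamma> \<epsilon> \<omega> x0 = y 0"
proof -
  have "(THE xy. hat_solution S F g1 g2 \<sigma> \<gamma> \<epsilon> (\<lambda>t. eta \<alpha> F \<epsilon> (path_shift t \<omega>)) x0 xy) = (x, y)"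
    using assms by (rule the1_equality)
  then show ?thesis
    using assms(2) unfolding hat_h_def hat_solution_def by (auto simp: zero_ereal_def)
qed

lemma tilde_h_eq:
  assumes "\<exists>!xy. tilde_solution S F g1 g2 \<sigma> \<gamma> \<epsilon> (\<lambda>t. xi F (path_shift t \<omega>)) x0 xy"
    and "tilde_solution S F g1 g2 \<sigma> \<gamma> \<epsilon> (\<lambda>t. xi F (path_shift t \<omega>)) x0 (x, y)"
  shows "tilde_h S F g1 g2 \<sigma> \<gamma> \<epsilon> \<omega> x0 = y 0"
proof -
  have "(THE xy. tilde_solution S F g1 g2 \<sigma> \<gamma> \<epsilon> (\<lambda>t. xi F (path_shift t \<omega>)) x0 xy) = (x, y)"
    using assms by (rule the1_equality)
  then show ?thesis
    using assms(2) unfolding tilde_h_def tilde_solution_def by (auto simp: zero_ereal_def)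
qed

section \<open>Equality in distribution of the two slow manifolds\<close>

theorem lemma6:
  fixes S :: "real^'m^'m" and F :: "real^'n^'n"
    and g1 :: "real^'m \<Rightarrow> real^'n \<Rightarrow> real^'m" and g2 :: "real^'m \<Rightarrow> real^'n \<Rightarrow> real^'n"
    and \<sigma> \<alpha> \<gamma>s \<gamma>f K \<gamma> :: real
    and P :: "(real \<Rightarrow> real^'n) measure"
  assumes \<sigma>: "\<sigma> > 0" and \<alpha>: "1 < \<alpha>" "\<alpha> < 2"
    and S_spectrum: "\<And>z. cmat_eigenvalue S z \<Longrightarrow> Re z \<ge> 0"
    and F_spectrum: "\<And>z. cmat_eigenvalue F z \<Longrightarrow> Re z < 0"
    and g_zero: "g1 0 0 = 0" "g2 0 0 = 0"
    and A1_consts: "\<gamma>s > 0" "\<gamma>f < 0"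
    and A1_S: "\<And>t x. t \<le> 0 \<Longrightarrow> norm (mexp (t *\<^sub>R S) *v x) \<le> exp (\<gamma>s * t) * norm x"
    and A1_F: "\<And>t y. t \<ge> 0 \<Longrightarrow> norm (mexp (t *\<^sub>R F) *v y) \<le> exp (\<gamma>f * t) * norm y"
    and A2_const: "K > 0"
    and A2_g1: "\<And>x1 y1 x2 y2. norm (g1 x1 y1 - g1 x2 y2) \<le> K * (norm (x1 - x2) + norm (y1 - y2))"
    and A2_g2: "\<And>x1 y1 x2 y2. norm (g2 x1 y1 - g2 x2 y2) \<le> K * (norm (x1 - x2) + norm (y1 - y2))"
    and A3: "K < - \<gamma>f"
    and \<gamma>: "\<gamma> > 0" "K < - (\<gamma> + \<gamma>f)"
    and P: "stable_levy_law \<alpha> P"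
  shows "\<exists>\<epsilon>0>0. \<forall>\<epsilon>. 0 < \<epsilon> \<and> \<epsilon> < \<epsilon>0 \<longrightarrow> (\<forall>\<Omega>. full_invariant_set \<alpha> F \<epsilon> P \<Omega> \<longrightarrow>
    (\<forall>\<omega>\<in>\<Omega>. \<forall>x0.
       (\<exists>!xy. hat_solution S F g1 g2 \<sigma> \<gamma> \<epsilon> (\<lambda>t. eta \<alpha> F \<epsilon> (path_shift t \<omega>)) x0 xy) \<and>
       (\<exists>!xy. tilde_solution S F g1 g2 \<sigma> \<gamma> \<epsilon> (\<lambda>t. xi F (path_shift t \<omega>)) x0 xy)) \<and>
    graphs_eq_in_distribution (restrict_space P \<Omega>)
      (random_graph (hat_h \<alpha> S F g1 g2 \<sigma> \<gamma> \<epsilon>)) (random_graph (tilde_h S F g1 g2 \<sigma> \<gamma> \<epsilon>)) \<and>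
    (\<forall>x0. eq_in_distribution (restrict_space P \<Omega>)
       (\<lambda>\<omega>. hat_h \<alpha> S F g1 g2 \<sigma> \<gamma> \<epsilon> \<omega> x0) (\<lambda>\<omega>. tilde_h S F g1 g2 \<sigma> \<gamma> \<epsilon> \<omega> x0)))"
proof -
  define \<kappa> where "\<kappa> = - \<gamma>f"
  \<comment> \<open>The value of \<epsilon> at which
    \<open>\<epsilon> * K / \<gamma> + K / (\<kappa> - \<gamma>)\<close> reaches 1.\<close>
  define \<epsilon>0 where "\<epsilon>0 = (1 - K / (\<kappa> - \<gamma>)) * \<gamma> / K"
  have \<kappa>: "\<gamma> < \<kappa>" "K / (\<kappa> - \<gamma>) < 1"
    using \<gamma> A2_const by (auto simp: \<kappa>_def)
  have "\<epsilon>0 > 0" using \<kappa> \<gamma> A2_const by (simp add: \<epsilon>0_def)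
  show ?thesis
  proof (intro exI[of _ \<epsilon>0] conjI allI impI, fact)
    fix \<epsilon> and \<Omega> :: "(real \<Rightarrow> real^'n) set"
    assume "0 < \<epsilon> \<and> \<epsilon> < \<epsilon>0" and full: "full_invariant_set \<alpha> F \<epsilon> P \<Omega>"
    then have \<epsilon>: "0 < \<epsilon>" "\<epsilon> < \<epsilon>0" by auto
    define G1 where "G1 p = g1 (fst p) (snd p)" for p
    define G2 where "G2 p = g2 (fst p) (snd p)" for p
    interpret lyapunov_perron "\<lambda>t v. mexp ((\<epsilon> * t) *\<^sub>R S) *v v" "\<lambda>t v. mexp (t *\<^sub>R F) *v v" G1 G2 K \<gamma> \<kappa> \<epsilon>
    proof
      show "norm (mexp ((\<epsilon> * t) *\<^sub>R S) *v v) \<le> norm v" if "t \<le> 0" for t v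
      proof -
        have "\<epsilon> * t \<le> 0" using \<epsilon> that by (simp add: mult_le_0_iff)
        moreover from this have "exp (\<gamma>s * (\<epsilon> * t)) * norm v \<le> norm v"
          using A1_consts by (intro mult_left_le_one_le) (auto simp: mult_le_0_iff)
        ultimately show ?thesis using A1_S[of "\<epsilon> * t" v] by simp
      qed
      show "norm (mexp (t *\<^sub>R F) *v v) \<le> exp (- \<kappa> * t) * norm v" if "0 \<le> t" for t v
        using A1_F[OF that] by (simp add: \<kappa>_def)
      show "\<epsilon> * K / \<gamma> + K / (\<kappa> - \<gamma>) < 1"
        using \<epsilon> \<gamma> A2_const by (simp add: \<epsilon>0_def field_simps)
    qed (use \<epsilon> \<gamma> \<kappa> g_zero A2_const A2_g1 A2_g2 in \<open>auto simp: G1_def G2_def sum_norm_def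
        matrix_vector_right_distrib matrix_vector_mult_scaleR intro!: linearI continuous_mexp_mult[of "\<lambda>t. \<epsilon> * t"] continuous_mexp_mult[of "\<lambda>t. t"] continuous_intros\<close>)

    \<comment> \<open>For t \<le> 0 the oriented integral from 0 to t is minus the integral over the
      interval, which accounts for the sign in \<open>step\<close>. The perturbation has slow
      component zero because the noise enters only through the fast variable.\<close>
    have solution_iff: "tilde_solution S F g1 g2 \<sigma> \<gamma> \<epsilon> z x0 = solution (\<lambda>s. (0, \<sigma> *\<^sub>R z s)) x0" for z x0
    proof
      fix p :: "(real \<Rightarrow> real^'m) \<times> (real \<Rightarrow> real^'n)"
      obtain x y where [simp]: "p = (x, y)" by (cases p)
      show "tilde_solution S F g1 g2 \<sigma> \<gamma> \<epsilon> z x0 p = solution (\<lambda>s. (0, \<sigma> *\<^sub>R z s)) x0 p"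
        by (auto simp: tilde_solution_def solution_def step_def G1_def G2_def
            interval_integral_zero_nonpos interval_integral_minf)
    qed
    have noise: "admissible (\<lambda>s. (0 :: real^'m, \<sigma> *\<^sub>R z s))"
      if z: "cadlag z" "sublinear_growth z" for z :: "real \<Rightarrow> real^'n"
    proof -
      obtain C where C: "\<And>t. t \<le> 0 \<Longrightarrow> norm (z t) \<le> C * exp (- \<gamma> * t)"
        using cadlag_sublinear_exp_bound[OF z \<gamma>(1)] by blast
      have "sum_norm (0 :: real^'m, \<sigma> *\<^sub>R z t) \<le> (\<sigma> * C) * exp (- \<gamma> * t)" if "t \<le> 0" for t
        using mult_left_mono[OF C[OF that], of \<sigma>] \<sigma> by (simp add: sum_norm_def mult.assoc)
      moreover note borel_measurable_cadlag[OF z(1), measurable]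
      ultimately show ?thesis unfolding admissible_def by (auto intro!: exI[of _ "\<sigma> * C"])
    qed

    \<comment> \<open>The fast component at time 0 of the Picard limit. As a total functional it may
      be evaluated at rescaled paths outside \<Omega>.\<close>
    define h where "h x0 \<omega> = lim (\<lambda>k. snd (picard (\<lambda>s. (0, \<sigma> *\<^sub>R noise F \<omega> s)) x0 k 0))" for x0 \<omega>
    have h_tilde: "y 0 = h x0 \<omega>"
      if "admissible (\<lambda>s. (0 :: real^'m, \<sigma> *\<^sub>R noise F \<omega> s))"
        "tilde_solution S F g1 g2 \<sigma> \<gamma> \<epsilon> (noise F \<omega>) x0 (x, y)" for x y x0 \<omega>
      using tendsto_snd[OF picard_tendsto_solution[OF that(1) that(2)[unfolded solution_iff], of 0]]
      unfolding h_def by (intro limI[symmetric]) simp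
    have h_measurable[measurable]: "h x0 \<in> borel_measurable (\<Pi>\<^sub>M t\<in>UNIV. borel)" for x0
    proof -
      have [measurable]: "(\<lambda>(\<omega>, t). noise F \<omega> t) \<in> borel_measurable ((\<Pi>\<^sub>M t\<in>UNIV. borel) \<Otimes>\<^sub>M borel)"
        by (rule measurable_noise) simp
      have "(\<lambda>(\<omega>, t). (0 :: real^'m, \<sigma> *\<^sub>R noise F \<omega> t)) \<in> borel_measurable ((\<Pi>\<^sub>M t\<in>UNIV. borel) \<Otimes>\<^sub>M borel)"
        by measurable
      note measurable_compose[OF _ measurable_picard[OF this, of x0], of "\<lambda>\<omega>. (\<omega>, 0)" "\<Pi>\<^sub>M t\<in>UNIV. borel"]
      then have "(\<lambda>\<omega>. picard (\<lambda>s. (0, \<sigma> *\<^sub>R noise F \<omega> s)) x0 k 0) \<in> borel_measurable (\<Pi>\<^sub>M t\<in>UNIV. borel)" for k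
        by simp
      then show ?thesis
        unfolding h_def
        by (intro borel_measurable_lim_metric borel_measurable_continuous_on[where f=snd] continuous_intros)
    qed

    have stable: "stable_levy_process \<alpha> P (\<lambda>t \<omega>. \<omega> t)" and sets_P: "sets P = sets skorokhod_borel"
      using P by (auto simp: stable_levy_law_def)
    then have "prob_space P" and eval[measurable]: "(\<lambda>\<omega>. \<omega> t) \<in> borel_measurable P" for t
      by (auto simp: stable_levy_process_def two_sided_levy_process_def)
    then interpret P: prob_space P by simp
    have \<Omega>: "\<Omega> \<in> sets P" "emeasure P \<Omega> = 1" "\<And>t \<omega>. \<omega> \<in> \<Omega> \<Longrightarrow> path_shift t \<omega> \<in> \<Omega>"
      using full by (auto simp: full_invariant_set_def)
    have "space P = D0"
      using sets_eq_imp_space_eq[OF sets_P] by (simp add: skorokhod_borel_def space_measure_of_conv)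
    then have cadlag: "cadlag \<omega>" if "\<omega> \<in> \<Omega>" for \<omega>
      using sets.sets_into_space[OF \<Omega>(1)] that by (auto simp: D0_def)
    have \<Omega>_props: "\<exists>I. has_rs_integral_minf (\<lambda>s. mexp ((- s / \<epsilon>) *\<^sub>R F)) \<omega> I"
        "\<exists>I. has_rs_integral_minf (\<lambda>s. mexp ((- s) *\<^sub>R F)) \<omega> I"
        "cadlag (\<lambda>t. eta \<alpha> F \<epsilon> (path_shift t \<omega>))" "sublinear_growth (\<lambda>t. eta \<alpha> F \<epsilon> (path_shift t \<omega>))"
        "cadlag (\<lambda>t. xi F (path_shift t \<omega>))" "sublinear_growth (\<lambda>t. xi F (path_shift t \<omega>))"
      if "\<omega> \<in> \<Omega>" for \<omega>
      using full that by (auto simp: full_invariant_set_def)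
    have noise_xi: "noise F \<omega> = (\<lambda>t. xi F (path_shift t \<omega>))" if "\<omega> \<in> \<Omega>" for \<omega>
      using noise_eq_xi[OF cadlag[OF that] \<Omega>_props(2)[OF \<Omega>(3)[OF that]]] by auto
    have noise_eta: "noise F (rescale \<alpha> \<epsilon> \<omega>) = (\<lambda>t. eta \<alpha> F \<epsilon> (path_shift (\<epsilon> * t) \<omega>))" if "\<omega> \<in> \<Omega>" for \<omega>
      using noise_rescale_eq_eta[OF cadlag[OF that] \<epsilon>(1) \<Omega>_props(1)[OF \<Omega>(3)[OF that]]] by auto
    have adm_xi: "admissible (\<lambda>s. (0 :: real^'m, \<sigma> *\<^sub>R xi F (path_shift s \<omega>)))" if "\<omega> \<in> \<Omega>" for \<omega>
      by (intro noise \<Omega>_props that)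
    have adm_eta: "admissible (\<lambda>s. (0 :: real^'m, \<sigma> *\<^sub>R eta \<alpha> F \<epsilon> (path_shift (\<epsilon> * s) \<omega>)))" if "\<omega> \<in> \<Omega>" for \<omega>
      using cadlag_scale_time[OF \<Omega>_props(3)[OF that] \<epsilon>(1)] sublinear_growth_scale_time[OF \<Omega>_props(4)[OF that] \<epsilon>(1)]
      by (rule noise)
    have ex_tilde: "\<exists>!xy. tilde_solution S F g1 g2 \<sigma> \<gamma> \<epsilon> (\<lambda>t. xi F (path_shift t \<omega>)) x0 xy" if "\<omega> \<in> \<Omega>" for \<omega> x0
      unfolding solution_iff by (rule ex1_solution[OF adm_xi[OF that]])
    have ex_hat: "\<exists>!xy. hat_solution S F g1 g2 \<sigma> \<gamma> \<epsilon> (\<lambda>t. eta \<alpha> F \<epsilon> (path_shift t \<omega>)) x0 xy" if "\<omega> \<in> \<Omega>" for \<omega> x0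
      by (rule ex1_hat_solution[OF \<epsilon>(1)]) (unfold solution_iff, rule ex1_solution[OF adm_eta[OF that]])
    have tilde: "tilde_h S F g1 g2 \<sigma> \<gamma> \<epsilon> \<omega> x0 = h x0 \<omega>" if \<omega>: "\<omega> \<in> \<Omega>" for \<omega> x0
    proof -
      obtain x y where xy: "tilde_solution S F g1 g2 \<sigma> \<gamma> \<epsilon> (\<lambda>t. xi F (path_shift t \<omega>)) x0 (x, y)"
        using ex_tilde[OF \<omega>] by (metis surj_pair)
      show ?thesis
        using h_tilde[of \<omega> x0 x y] adm_xi[OF \<omega>] xy unfolding tilde_h_eq[OF ex_tilde[OF \<omega>] xy] noise_xi[OF \<omega>]
        by blast
    qed
    have hat: "hat_h \<alpha> S F g1 g2 \<sigma> \<gamma> \<epsilon> \<omega> x0 = h x0 (rescale \<alpha> \<epsilon> \<omega>)" if \<omega>: "\<omega> \<in> \<Omega>" for \<omega> x0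
    proof -
      obtain x y where xy: "hat_solution S F g1 g2 \<sigma> \<gamma> \<epsilon> (\<lambda>t. eta \<alpha> F \<epsilon> (path_shift t \<omega>)) x0 (x, y)"
        using ex_hat[OF \<omega>] by (metis surj_pair)
      then have "tilde_solution S F g1 g2 \<sigma> \<gamma> \<epsilon> (noise F (rescale \<alpha> \<epsilon> \<omega>)) x0 (\<lambda>t. x (\<epsilon> * t), \<lambda>t. y (\<epsilon> * t))"
        unfolding noise_eta[OF \<omega>] hat_solution_iff_tilde_solution[OF \<epsilon>(1)] .
      then have "y (\<epsilon> * 0) = h x0 (rescale \<alpha> \<epsilon> \<omega>)"
        using adm_eta[OF \<omega>] by (intro h_tilde) (simp_all add: noise_eta[OF \<omega>])
      then show ?thesis unfolding hat_h_eq[OF ex_hat[OF \<omega>] xy] by simp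
    qed

    have space_\<Omega>: "space (restrict_space P \<Omega>) = \<Omega>"
      using sets.sets_into_space[OF \<Omega>(1)] by (auto simp: space_restrict_space)
    have path[measurable]: "(\<lambda>\<omega>. \<omega>) \<in> measurable P (\<Pi>\<^sub>M t\<in>UNIV. borel)"
      "rescale \<alpha> \<epsilon> \<in> measurable P (\<Pi>\<^sub>M t\<in>UNIV. borel)"
      by (auto intro!: measurable_PiM_single' simp: PiE_UNIV_domain rescale_def)
    have eq: "eq_in_distribution (restrict_space P \<Omega>)
       (\<lambda>\<omega>. hat_h \<alpha> S F g1 g2 \<sigma> \<gamma> \<epsilon> \<omega> x0) (\<lambda>\<omega>. tilde_h S F g1 g2 \<sigma> \<gamma> \<epsilon> \<omega> x0)" for x0
    proof -
      have m: "h x0 \<in> borel_measurable P" "(\<lambda>\<omega>. h x0 (rescale \<alpha> \<epsilon> \<omega>)) \<in> borel_measurable P"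
        using measurable_compose[OF path(1) h_measurable] measurable_compose[OF path(2) h_measurable] by auto
      have "distr (restrict_space P \<Omega>) borel (\<lambda>\<omega>. hat_h \<alpha> S F g1 g2 \<sigma> \<gamma> \<epsilon> \<omega> x0) =
          distr (restrict_space P \<Omega>) borel (\<lambda>\<omega>. h x0 (rescale \<alpha> \<epsilon> \<omega>))"
        by (rule distr_cong) (auto simp: space_\<Omega> hat)
      \<comment> \<open>Passing from \<Omega> to the whole space is necessary here: the invariance
        of the law under \<open>rescale\<close> holds for \<open>P\<close>, and rescaled paths may
        leave \<Omega>.\<close>
      also have "\<dots> = distr P borel (\<lambda>\<omega>. h x0 (rescale \<alpha> \<epsilon> \<omega>))"
        by (rule P.distr_restrict_space_full[OF \<Omega>(1,2) m(2)])
      also have "\<dots> = distr (distr P (\<Pi>\<^sub>M t\<in>UNIV. borel) (rescale \<alpha> \<epsilon>)) borel (h x0)"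
        by (subst distr_distr) (auto simp: comp_def path)
      also have "\<dots> = distr (distr P (\<Pi>\<^sub>M t\<in>UNIV. borel) (\<lambda>\<omega>. \<omega>)) borel (h x0)"
        using distr_rescale[OF stable \<epsilon>(1)] by simp
      also have "\<dots> = distr P borel (h x0)"
        by (subst distr_distr) (auto simp: comp_def path)
      also have "\<dots> = distr (restrict_space P \<Omega>) borel (h x0)"
        by (rule P.distr_restrict_space_full[OF \<Omega>(1,2) m(1), symmetric])
      also have "\<dots> = distr (restrict_space P \<Omega>) borel (\<lambda>\<omega>. tilde_h S F g1 g2 \<sigma> \<gamma> \<epsilon> \<omega> x0)"
        by (rule distr_cong) (auto simp: space_\<Omega> tilde)
      finally have "distr (restrict_space P \<Omega>) borel (\<lambda>\<omega>. hat_h \<alpha> S F g1 g2 \<sigma> \<gamma> \<epsilon> \<omega> x0) =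
          distr (restrict_space P \<Omega>) borel (\<lambda>\<omega>. tilde_h S F g1 g2 \<sigma> \<gamma> \<epsilon> \<omega> x0)" .
      moreover have "(\<lambda>\<omega>. hat_h \<alpha> S F g1 g2 \<sigma> \<gamma> \<epsilon> \<omega> x0) \<in> borel_measurable (restrict_space P \<Omega>)"
        by (rule measurable_cong[THEN iffD2, OF _ measurable_restrict_space1[OF m(2)]]) (simp add: space_\<Omega> hat)
      moreover have "(\<lambda>\<omega>. tilde_h S F g1 g2 \<sigma> \<gamma> \<epsilon> \<omega> x0) \<in> borel_measurable (restrict_space P \<Omega>)"
        by (rule measurable_cong[THEN iffD2, OF _ measurable_restrict_space1[OF m(1)]]) (simp add: space_\<Omega> tilde)
      ultimately show ?thesis
        unfolding eq_in_distribution_def by blast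
    qed
    show "(\<forall>\<omega>\<in>\<Omega>. \<forall>x0.
       (\<exists>!xy. hat_solution S F g1 g2 \<sigma> \<gamma> \<epsilon> (\<lambda>t. eta \<alpha> F \<epsilon> (path_shift t \<omega>)) x0 xy) \<and>
       (\<exists>!xy. tilde_solution S F g1 g2 \<sigma> \<gamma> \<epsilon> (\<lambda>t. xi F (path_shift t \<omega>)) x0 xy))"
      using ex_hat ex_tilde by blast
    show "eq_in_distribution (restrict_space P \<Omega>)
       (\<lambda>\<omega>. hat_h \<alpha> S F g1 g2 \<sigma> \<gamma> \<epsilon> \<omega> x0) (\<lambda>\<omega>. tilde_h S F g1 g2 \<sigma> \<gamma> \<epsilon> \<omega> x0)" for x0
      by (rule eq)
    show "graphs_eq_in_distribution (restrict_space P \<Omega>)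
      (random_graph (hat_h \<alpha> S F g1 g2 \<sigma> \<gamma> \<epsilon>)) (random_graph (tilde_h S F g1 g2 \<sigma> \<gamma> \<epsilon>))"
      unfolding graphs_eq_in_distribution_def
    proof
      fix x0
      show "\<exists>X Y. (\<forall>\<omega>\<in>space (restrict_space P \<Omega>).
          {y. (x0, y) \<in> random_graph (hat_h \<alpha> S F g1 g2 \<sigma> \<gamma> \<epsilon>) \<omega>} = {X \<omega>} \<and>
          {y. (x0, y) \<in> random_graph (tilde_h S F g1 g2 \<sigma> \<gamma> \<epsilon>) \<omega>} = {Y \<omega>}) \<and>
          eq_in_distribution (restrict_space P \<Omega>) X Y"
        by (rule exI, rule exI, rule conjI[OF _ eq[of x0]]) (auto simp: random_graph_def)
    qed
  qed
qed

end
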